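(* For $\tau$ in the upper half-plane and complex $x,y$ with $\theta_1(x|5\tau)\theta_1(y|5\tau)\ne0$, \begin{align*} & q^{5/2}\left(e^{2ix}\theta_1^5(x+\pi\tau|5\tau)-e^{-2ix}\theta_1^5(x-\pi\tau|5\tau)\right)\left(e^{4iy}\theta_1^5(y+2\pi\tau|5\tau)-e^{-4iy}\theta_1^5(y-2\pi\tau|5\tau)\right)\\ &-q^{5/2}\left(e^{2iy}\theta_1^5(y+\pi\tau|5\tau)-e^{-2iy}\theta_1^5(y-\pi\tau|5\tau)\right)\left(e^{4ix}\theta_1^5(x+2\pi\tau|5\tau)-e^{-4ix}\theta_1^5(x-2\pi\tau|5\tau)\right)\\ &=\left(10\eta^4(\tau)\eta^4(5\tau)+\frac{\eta^{10}(\tau)}{\eta^2(5\tau)}\right) \frac{\theta_1(x+y|5\tau)\theta_1(x-y|5\tau)\theta_1(2x|5\tau)\theta_1(2y|5\tau)}{\theta_1(x|5\tau)\theta_1(y|5\tau)}. \end{align*}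
   Context: $q=e^{2\pi i\tau}$, $q^a=e^{2\pi i a\tau}$; $\eta(\tau)=q^{1/24}\prod_{n\ge1}(1-q^n)$; $\theta_1(z|\tau)=2\sum_{n\ge0}(-1)^nq^{(2n+1)^2/8}\sin(2n+1)z$. *)

theory Defs
  imports "HOL-Analysis.Analysis"
begin

text \<open>
  Fractional powers of the nome are read off the variable \<open>\<tau>\<close> and not off \<open>q\<close>, so that
  no branch choice is involved: \<open>q\<^sup>a = exp (2 \<pi> \<i> a \<tau>)\<close>.
\<close>

definition qpow :: "complex \<Rightarrow> real \<Rightarrow> complex" where
  "qpow \<tau> a = exp (2 * of_real pi * \<i> * of_real a * \<tau>)"

definition dedekind_eta :: "complex \<Rightarrow> complex" where
  "dedekind_eta \<tau> = qpow \<tau> (1 / 24) * prodinf (\<lambda>n. 1 - qpow \<tau> (real (Suc n)))"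

definition theta1 :: "complex \<Rightarrow> complex \<Rightarrow> complex" where
  "theta1 z \<tau> =
     2 * (\<Sum>n. (- 1) ^ n * qpow \<tau> ((2 * real n + 1) ^ 2 / 8) * sin ((2 * of_nat n + 1) * z))"

end

theory Submission
  imports Defs
begin

text \<open>
  Put \<open>T = 5\<tau>\<close>. As functions of \<open>x\<close>, both sides are even and lie in the space of theta functions
  of degree 5, odd frequencies and multiplier \<open>-1\<close>; the even part of that space is a plane. Both
  sides are antisymmetric in \<open>x\<close> and \<open>y\<close>, and an alternating form on a plane is unique up to a
  scalar, so they are proportional. The quotient \<open>\<theta>\<^sub>1(2x)/\<theta>\<^sub>1(x)\<close> causes no singularity because the
  quintuple product identity turns it into an everywhere convergent series.

  The scalar is found at \<open>x = \<pi>\<tau>\<close>, \<open>y = 2\<pi>\<tau>\<close>, where everything is expressed by \<open>a = \<theta>\<^sub>1(\<pi>\<tau>|5\<tau>)\<close> and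
  \<open>b = \<theta>\<^sub>1(2\<pi>\<tau>|5\<tau>)\<close>. With \<open>v = q\<^bsup>3/10\<^esup> b/a\<close>, the inverse of the Rogers-Ramanujan continued fraction,
  the claim becomes \<open>v\<^sup>5 - 11 - v\<^bsup>-5\<^esup> = (\<eta>(\<tau>)/\<eta>(5\<tau>))\<^sup>6\<close>. This follows by dissecting the pentagonal
  number series modulo 5, which gives \<open>\<eta>(\<tau>/5) = \<eta>(5\<tau>) (v - 1 - 1/v)\<close>, and multiplying over the
  translates \<open>\<tau> + 24k\<close>, \<open>k < 5\<close>, which replace \<open>v\<close> by its multiples by fifth roots of unity.
\<close>

section \<open>Summability and the q-binomial theorem\<close>

text \<open>A theta function is encoded by the existence of Fourier coefficients with a twisted
  period. Products of theta functions are then Cauchy products, and the dimension of a space is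
  bounded by listing the coefficients over one period. Symmetries of a function pass to its
  coefficients by averaging. The point \<open>x = \<pi>\<tau>\<close>,
  \<open>y = 2\<pi>\<tau>\<close> suits the comparison because \<open>\<theta>\<^sub>1\<close>
  vanishes at 0 and has the quasi-period \<open>5\<pi>\<tau>\<close>: every argument that occurs is
  a small multiple of \<open>\<pi>\<tau>\<close> and reduces to 0, \<open>\<pi>\<tau>\<close> or
  \<open>2\<pi>\<tau>\<close>. The evaluation produces \<open>v^5 - 1 - v^(-5)\<close>, so the
  coefficient 10 on the right is the gap between this 1 and the 11 of the continued fraction
  identity; 11 itself is \<open>\<alpha>^5 + (1 - \<alpha>)^5\<close> for the golden ratio
  \<open>\<alpha>\<close>. Translates by 24 rather than by 1 leave \<open>\<eta>\<close> exactly
  invariant, so no 24th roots of unity have to be tracked; as 24 is prime to 5, the translates of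
  \<open>v\<close> still run through all fifth roots of unity.\<close>

lemma sums_fold_int:
  fixes f :: "int \<Rightarrow> 'a::real_normed_vector"
  assumes "(f has_sum S) UNIV"
  shows "(\<lambda>n::nat. f (int n) + f (- int n - 1)) sums S"
proof -
  have "(f has_sum S) (UNIV :: int set) \<longleftrightarrow>
      ((\<lambda>(n, b). f (if b then int n else - int n - 1)) has_sum S) ((UNIV :: nat set) \<times> (UNIV :: bool set))"
    by (rule has_sum_reindex_bij_witness[where
        j = "\<lambda>k. (nat (if k \<ge> 0 then k else - k - 1), k \<ge> 0)" and
        i = "\<lambda>(n, b). if b then int n else - int n - 1"]) (auto split: if_splits)
  hence "((\<lambda>n. f (int n) + f (- int n - 1)) has_sum S) (UNIV :: nat set)"
    using assms
    by (intro has_sum_SigmaD[where f = "\<lambda>(n, b). f (if b then int n else - int n - 1)" and B = "\<lambda>_. UNIV"])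
       (auto intro!: has_sum_finiteI simp: UNIV_bool)
  thus ?thesis by (rule has_sum_imp_sums)
qed

lemma summable_on_int_exp_neg_abs: "(\<lambda>n::int. exp (- real_of_int \<bar>n\<bar>)) summable_on UNIV"
proof -
  have s: "summable (\<lambda>n::nat. exp (- real n))"
    using summable_geometric[of "exp (-1::real)"] by (simp add: exp_of_nat_mult[symmetric])
  have "(\<lambda>n::nat. exp (- real n)) summable_on UNIV"
    by (intro summable_nonneg_imp_summable_on s) auto
  hence "(\<lambda>n::int. exp (- real_of_int \<bar>n\<bar>)) summable_on range int"
       "(\<lambda>n::int. exp (- real_of_int \<bar>n\<bar>)) summable_on range (\<lambda>n. - int n)"
    by (subst summable_on_reindex; simp add: o_def inj_on_def)+
  hence "(\<lambda>n::int. exp (- real_of_int \<bar>n\<bar>)) summable_on (range int \<union> range (\<lambda>n. - int n))"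
    by (rule summable_on_union)
  also have "range int \<union> range (\<lambda>n. - int n) = UNIV"
    by (auto simp: image_iff) (metis int_cases2)
  finally show ?thesis .
qed

lemma summable_on_gaussian:
  fixes c b :: real
  assumes "c > 0"
  shows "(\<lambda>n::int. exp (- c * real_of_int n ^ 2 + b * real_of_int n)) summable_on UNIV"
proof (rule summable_on_comparison_test)
  \<comment> \<open>\<open>K\<close> is the exponential of the maximum of
    \<open>- c * x\<^sup>2 + (\<bar>b\<bar> + 1) * x\<close>; the extra 1 leaves a summable factor
    \<open>exp (- x)\<close>.\<close>
  define K where "K = exp ((\<bar>b\<bar> + 1)\<^sup>2 / (4 * c))"
  show "(\<lambda>n::int. K * exp (- real_of_int \<bar>n\<bar>)) summable_on UNIV"
    by (intro summable_on_cmult_right summable_on_int_exp_neg_abs)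
  show "exp (- c * real_of_int n ^ 2 + b * real_of_int n) \<le> K * exp (- real_of_int \<bar>n\<bar>)" for n
  proof -
    define x where "x = real_of_int \<bar>n\<bar>"
    have "b * real_of_int n \<le> \<bar>b\<bar> * x"
      unfolding x_def using abs_ge_self[of "b * real_of_int n"] by (simp add: abs_mult)
    moreover have "- c * x ^ 2 + (\<bar>b\<bar> + 1) * x \<le> (\<bar>b\<bar> + 1)\<^sup>2 / (4 * c)"
    proof -
      have "0 \<le> (2 * c * x - (\<bar>b\<bar> + 1))\<^sup>2" by simp
      hence "4 * c * (- c * x ^ 2 + (\<bar>b\<bar> + 1) * x) \<le> (\<bar>b\<bar> + 1)\<^sup>2"
        by (simp add: power2_eq_square algebra_simps)
      thus ?thesis using assms by (simp add: field_simps)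
    qed
    moreover have "x ^ 2 = real_of_int n ^ 2" by (simp add: x_def)
    ultimately show ?thesis
      unfolding K_def exp_add[symmetric] exp_le_cancel_iff x_def[symmetric]
      by (simp add: algebra_simps)
  qed
qed auto

lemma summable_on_theta_terms:
  fixes h :: "int \<Rightarrow> complex" and T z :: complex
  assumes "Im T > 0" "\<And>n. norm (h n) \<le> B"
  shows "(\<lambda>n. h n * exp (\<i> * T * of_int n ^ 2 + \<i> * of_int n * z)) summable_on UNIV"
proof -
  have "(\<lambda>n. norm (h n * exp (\<i> * T * of_int n ^ 2 + \<i> * of_int n * z))) summable_on UNIV"
  proof (rule summable_on_comparison_test)
    show "(\<lambda>n::int. B * exp (- Im T * real_of_int n ^ 2 + (- Im z) * real_of_int n)) summable_on UNIV"
      by (intro summable_on_cmult_right summable_on_gaussian assms)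
    have re: "Re (\<i> * T * of_int n ^ 2 + \<i> * of_int n * z) =
          - Im T * real_of_int n ^ 2 + (- Im z) * real_of_int n" for n :: int
    proof -
      have "(of_int n :: complex) ^ 2 = of_real (real_of_int n ^ 2)" by simp
      thus ?thesis by (simp del: of_real_power of_int_power)
    qed
    show "norm (h n * exp (\<i> * T * of_int n ^ 2 + \<i> * of_int n * z)) \<le>
          B * exp (- Im T * real_of_int n ^ 2 + (- Im z) * real_of_int n)" for n
      unfolding norm_mult norm_exp_eq_Re re by (intro mult_right_mono assms) auto
  qed auto
  thus ?thesis by (simp add: summable_on_iff_abs_summable_on_complex)
qed

section \<open>q-Pochhammer products and Gaussian binomials\<close>

definition qpoch :: "complex \<Rightarrow> complex \<Rightarrow> complex" where
  "qpoch w q = (\<Prod>n. 1 - w * q ^ n)"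

lemma convergent_prod_qpoch:
  fixes w q :: complex
  assumes "norm q < 1"
  shows "convergent_prod (\<lambda>n. 1 - w * q ^ n)"
proof (intro abs_convergent_prod_imp_convergent_prod summable_imp_abs_convergent_prod)
  have "summable (\<lambda>n. norm w * norm q ^ n)"
    using assms by (intro summable_mult summable_geometric) auto
  thus "summable (\<lambda>n. norm (1 - w * q ^ n - 1))"
    by (simp add: norm_mult norm_power)
qed

lemma qpoch_LIMSEQ:
  assumes "norm q < 1"
  shows "(\<lambda>N. \<Prod>n<N. 1 - w * q ^ n) \<longlonglongrightarrow> qpoch w q"
proof -
  have "(\<lambda>N. \<Prod>n\<le>N. 1 - w * q ^ n) \<longlonglongrightarrow> qpoch w q"
    unfolding qpoch_def by (intro convergent_prod_LIMSEQ convergent_prod_qpoch assms)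
  thus ?thesis
    by (subst filterlim_sequentially_Suc[symmetric]) (simp add: lessThan_Suc_atMost)
qed

lemma qpoch_nonzero:
  assumes "norm q < 1" "\<And>n. w * q ^ n \<noteq> 1"
  shows "qpoch w q \<noteq> 0"
  unfolding qpoch_def using assms
  by (intro prodinf_nonzero convergent_prod_qpoch) auto

lemma mult_power_neq_1:
  fixes w q :: complex
  assumes "norm q < 1" "norm w < 1"
  shows "w * q ^ n \<noteq> 1"
proof
  assume "w * q ^ n = 1"
  hence "norm w * norm q ^ n = 1" by (metis norm_mult norm_one norm_power)
  moreover have "norm w * norm q ^ n \<le> norm w * 1"
    using assms by (intro mult_left_mono power_le_one) auto
  ultimately show False using assms by simp
qed

text \<open>The factors are written \<open>1 - q * q ^ i\<close> so that these are literally the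
  partial products of \<open>qpoch q q\<close>.\<close>

definition qfac :: "complex \<Rightarrow> nat \<Rightarrow> complex" where
  "qfac q n = (\<Prod>i<n. 1 - q * q ^ i)"

definition qbinomial :: "complex \<Rightarrow> nat \<Rightarrow> nat \<Rightarrow> complex" where
  "qbinomial q n k = (if k \<le> n then qfac q n / (qfac q k * qfac q (n - k)) else 0)"

lemma qfac_nonzero: "norm q < 1 \<Longrightarrow> qfac q n \<noteq> 0"
  using mult_power_neq_1[of q q] by (auto simp: qfac_def)

lemma qfac_Suc: "qfac q (Suc n) = qfac q n * (1 - q ^ Suc n)"
  by (simp add: qfac_def)

text \<open>The q-Pascal rule. With \<open>n = k + d + 1\<close> it comes from writing
  \<open>1 - q ^ Suc n\<close> as \<open>(1 - q ^ Suc d) + q ^ Suc d * (1 - q ^ Suc k)\<close>: each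
  part cancels one factor of the denominator.\<close>

lemma qbinomial_Suc_Suc:
  assumes "norm q < 1"
  shows "qbinomial q (Suc n) (Suc k) = qbinomial q n (Suc k) + q ^ (n - k) * qbinomial q n k"
proof -
  consider "k > n" | "k = n" | d where "n = Suc (k + d)"
    by (metis less_iff_Suc_add linorder_neqE_nat)
  thus ?thesis
  proof cases
    case (3 d)
    have nz: "qfac q m \<noteq> 0" for m using qfac_nonzero[OF assms] .
    have nz': "1 - q ^ Suc m \<noteq> 0" for m
      using nz[of "Suc m"] unfolding qfac_Suc by auto
    have e: "Suc (Suc (k + d)) - Suc k = Suc d" "Suc (k + d) - Suc k = d" "Suc (k + d) - k = Suc d"
      by auto
    have p: "(1 - q ^ Suc (Suc (k + d))) = (1 - q ^ Suc d) + q ^ Suc d * (1 - q ^ Suc k)"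
      by (simp add: power_add algebra_simps)
    have "qbinomial q (Suc n) (Suc k) =
        qfac q n * ((1 - q ^ Suc d) + q ^ Suc d * (1 - q ^ Suc k)) /
          ((qfac q k * (1 - q ^ Suc k)) * (qfac q d * (1 - q ^ Suc d)))"
      unfolding qbinomial_def 3 e
      by (subst p [symmetric]) (simp add: qfac_Suc)
    also have "\<dots> = qfac q n / ((qfac q k * (1 - q ^ Suc k)) * qfac q d) +
        q ^ Suc d * (qfac q n / (qfac q k * (qfac q d * (1 - q ^ Suc d))))"
      using nz[of k] nz[of d] nz'[of k] nz'[of d]
      by (simp del: power_Suc add: divide_simps) (simp add: algebra_simps)
    also have "\<dots> = qbinomial q n (Suc k) + q ^ (n - k) * qbinomial q n k"
      unfolding qbinomial_def 3 e by (simp add: qfac_Suc)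
    finally show ?thesis .
  qed (use qfac_nonzero[OF assms] in \<open>auto simp: qbinomial_def qfac_def\<close>)
qed

lemma qbinomial_theorem:
  assumes "norm q < 1"
  shows "(\<Prod>i<n. 1 + z * q ^ i) = (\<Sum>k\<le>n. q ^ (k choose 2) * qbinomial q n k * z ^ k)"
proof (induction n)
  case 0
  thus ?case by (simp add: qbinomial_def qfac_def numeral_2_eq_2)
next
  case (Suc n)
  let ?t = "\<lambda>n k. q ^ (k choose 2) * qbinomial q n k * z ^ k"
  have q0: "qbinomial q m 0 = 1" for m
    using qfac_nonzero[OF assms, of m] by (simp add: qbinomial_def qfac_def)
  have "(\<Sum>k\<le>Suc n. ?t (Suc n) k) = 1 + (\<Sum>k\<le>n. ?t (Suc n) (Suc k))"
    by (subst sum.atMost_Suc_shift) (simp add: q0 numeral_2_eq_2)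
  also have "(\<Sum>k\<le>n. ?t (Suc n) (Suc k)) = (\<Sum>k\<le>n. ?t n (Suc k) + z * q ^ n * ?t n k)"
  proof (intro sum.cong refl)
    fix k assume k: "k \<in> {..n}"
    have c: "Suc k choose 2 = k + (k choose 2)" by (simp add: numeral_2_eq_2)
    have "q ^ (Suc k choose 2) * q ^ (n - k) = q ^ n * q ^ (k choose 2)"
      using k unfolding c by (simp add: power_add[symmetric] add.commute)
    thus "?t (Suc n) (Suc k) = ?t n (Suc k) + z * q ^ n * ?t n k"
      unfolding qbinomial_Suc_Suc[OF assms] by (simp add: algebra_simps)
  qed
  also have "1 + (\<Sum>k\<le>n. ?t n (Suc k) + z * q ^ n * ?t n k) =
      (1 + (\<Sum>k\<le>n. ?t n (Suc k))) + z * q ^ n * (\<Sum>k\<le>n. ?t n k)"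
    by (simp add: sum.distrib sum_distrib_left)
  also have "1 + (\<Sum>k\<le>n. ?t n (Suc k)) = (\<Sum>k\<le>Suc n. ?t n k)"
    by (subst sum.atMost_Suc_shift) (simp add: q0 numeral_2_eq_2)
  also have "\<dots> = (\<Sum>k\<le>n. ?t n k)" by (simp add: qbinomial_def)
  finally show ?case using Suc.IH by (simp add: algebra_simps)
qed

section \<open>The Jacobi triple product\<close>

text \<open>In terms of \<open>q = exp (2 * pi * \<i> * \<tau>)\<close> and
  \<open>w = exp (2 * \<i> * z)\<close> this is \<open>(-1)^n * q^(n(n-1)/2) * w^n\<close>. Keeping
  \<open>\<tau>\<close> and \<open>z\<close> as arguments allows fractional shifts without a choice
  of root.\<close>

definition jterm :: "complex \<Rightarrow> complex \<Rightarrow> int \<Rightarrow> complex" where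
  "jterm \<tau> z n = (-1) powi n * exp (of_real pi * \<i> * \<tau> * of_int (n * (n - 1)) + 2 * \<i> * of_int n * z)"

lemma jterm_summable:
  assumes "Im \<tau> > 0"
  shows "jterm \<tau> z summable_on UNIV"
proof -
  have "(\<lambda>n. (-1) powi n * exp (\<i> * (of_real pi * \<tau>) * of_int n ^ 2 +
            \<i> * of_int n * (2 * z - of_real pi * \<tau>))) summable_on UNIV"
    by (rule summable_on_theta_terms[where B = 1]) (use assms in \<open>auto simp: norm_power_int\<close>)
  also have "(\<lambda>n::int. (-1) powi n * exp (\<i> * (of_real pi * \<tau>) * of_int n ^ 2 +
            \<i> * of_int n * (2 * z - of_real pi * \<tau>))) = jterm \<tau> z"
    unfolding jterm_def
    by (intro ext arg_cong[where f = "\<lambda>x. _ * exp x"]) (simp add: algebra_simps power2_eq_square)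
  finally show ?thesis .
qed

text \<open>The lower half is reversed because in the finite triple product it carries the negative
  powers of \<open>q\<close>, with exponent -1 next to the middle.\<close>

lemma prod_lessThan_double:
  fixes f :: "nat \<Rightarrow> 'a::comm_monoid_mult"
  shows "(\<Prod>i<2 * N. f i) = (\<Prod>i<N. f (N - 1 - i)) * (\<Prod>i<N. f (i + N))"
proof -
  have "(\<Prod>i<N + M. f i) = (\<Prod>i<N. f i) * (\<Prod>i<M. f (i + N))" for M
    by (induction M) (simp_all add: mult_ac add.commute)
  from this[of N] show ?thesis
    using prod.nat_diff_reindex[of f N] by (simp add: mult_2)
qed

text \<open>This is the q-binomial theorem for \<open>2 * N\<close> factors at
  \<open>- w / q ^ N\<close>. The upper \<open>N\<close> factors are \<open>1 - w * q ^ i\<close>;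
  from each lower factor \<open>1 - w / q ^ Suc i\<close> one pulls out
  \<open>- w / q ^ Suc i\<close>, which leaves \<open>1 - q / w * q ^ i\<close>. The collected
  constant \<open>K\<close> is the same one that appears when the sum is centred at
  \<open>k = N\<close>.\<close>

lemma finite_jacobi_triple_product:
  fixes \<tau> z :: complex
  assumes "Im \<tau> > 0"
  defines "q \<equiv> exp (2 * of_real pi * \<i> * \<tau>)" and "w \<equiv> exp (2 * \<i> * z)"
  shows "(\<Prod>i<N. 1 - w * q ^ i) * (\<Prod>i<N. 1 - q / w * q ^ i) =
         (\<Sum>k\<le>2 * N. jterm \<tau> z (int k - int N) * qbinomial q (2 * N) k)"
proof -
  have q: "norm q < 1" using assms by (simp add: q_def)
  have nz: "q \<noteq> 0" "w \<noteq> 0" by (simp_all add: q_def w_def)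
  define K where "K = (\<Prod>i<N. - w / q ^ Suc i)"
  have K: "K = (-1) ^ N * exp (2 * \<i> * of_nat N * z - of_real pi * \<i> * \<tau> * of_nat (N * (N + 1)))"
    unfolding K_def
  proof (induction N)
    case (Suc N)
    have "- w / q ^ Suc N = - exp (2 * \<i> * z - 2 * of_real pi * \<i> * \<tau> * of_nat (Suc N))"
      unfolding q_def w_def exp_of_nat_mult[symmetric] exp_diff by (simp add: mult_ac)
    thus ?case
      unfolding prod.lessThan_Suc Suc.IH
      by (simp add: exp_add[symmetric] exp_diff[symmetric] algebra_simps)
  qed auto
  have "(\<Prod>i<2 * N. 1 + (- w / q ^ N) * q ^ i) =
      (\<Prod>i<N. 1 + (- w / q ^ N) * q ^ (N - 1 - i)) * (\<Prod>i<N. 1 + (- w / q ^ N) * q ^ (i + N))"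
    by (rule prod_lessThan_double)
  also have "(\<Prod>i<N. 1 + (- w / q ^ N) * q ^ (N - 1 - i)) = (\<Prod>i<N. (- w / q ^ Suc i) * (1 - q / w * q ^ i))"
  proof (intro prod.cong refl)
    fix i assume "i \<in> {..<N}"
    hence "q ^ N = q ^ (N - 1 - i) * q ^ Suc i" by (subst power_add[symmetric]) auto
    thus "1 + (- w / q ^ N) * q ^ (N - 1 - i) = (- w / q ^ Suc i) * (1 - q / w * q ^ i)"
      using nz by (simp add: field_simps)
  qed
  also have "\<dots> = K * (\<Prod>i<N. 1 - q / w * q ^ i)"
    unfolding K_def by (rule prod.distrib)
  also have "(\<Prod>i<N. 1 + (- w / q ^ N) * q ^ (i + N)) = (\<Prod>i<N. 1 - w * q ^ i)"
    using nz by (intro prod.cong) (simp_all add: power_add field_simps)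
  finally have "K * ((\<Prod>i<N. 1 - w * q ^ i) * (\<Prod>i<N. 1 - q / w * q ^ i)) =
       (\<Sum>k\<le>2 * N. q ^ (k choose 2) * qbinomial q (2 * N) k * (- w / q ^ N) ^ k)"
    unfolding qbinomial_theorem[OF q] by (simp add: mult_ac)
  also have "\<dots> = (\<Sum>k\<le>2 * N. K * (jterm \<tau> z (int k - int N) * qbinomial q (2 * N) k))"
  proof (intro sum.cong refl)
    fix k
    have c: "of_nat (k choose 2) = (of_nat k * (of_nat k - 1) / 2 :: complex)"
      by (induction k) (simp_all add: numeral_2_eq_2 field_simps)
    have sg: "(-1 :: complex) ^ N * (-1) powi (int k - int N) = (-1) ^ k"
      by (subst power_int_diff) auto
    have "q ^ (k choose 2) * (- w / q ^ N) ^ k =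
        (-1) ^ k * (q ^ (k choose 2) * (w / q ^ N) ^ k)"
      by (metis (no_types, lifting) minus_divide_left mult.left_commute power_minus)
    also have "q ^ (k choose 2) * (w / q ^ N) ^ k =
        exp (2 * of_real pi * \<i> * \<tau> * (of_nat k * (of_nat k - 1) / 2)
           + of_nat k * (2 * \<i> * z - 2 * of_real pi * \<i> * \<tau> * of_nat N))"
      unfolding q_def w_def exp_of_nat_mult[symmetric] exp_diff[symmetric] exp_add[symmetric] c
      by (simp add: mult_ac)
    also have "2 * of_real pi * \<i> * \<tau> * (of_nat k * (of_nat k - 1) / 2)
           + of_nat k * (2 * \<i> * z - 2 * of_real pi * \<i> * \<tau> * of_nat N) =
        (2 * \<i> * of_nat N * z - of_real pi * \<i> * \<tau> * of_nat (N * (N + 1))) +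
        (of_real pi * \<i> * \<tau> * of_int ((int k - int N) * ((int k - int N) - 1)) + 2 * \<i> * of_int (int k - int N) * z)"
      by (simp add: field_simps)
    finally have "q ^ (k choose 2) * (- w / q ^ N) ^ k = K * jterm \<tau> z (int k - int N)"
      unfolding K jterm_def exp_add sg[symmetric] by (simp add: mult_ac)
    thus "q ^ (k choose 2) * qbinomial q (2 * N) k * (- w / q ^ N) ^ k =
        K * (jterm \<tau> z (int k - int N) * qbinomial q (2 * N) k)"
      by (simp add: mult_ac)
  qed
  finally have "K * ((\<Prod>i<N. 1 - w * q ^ i) * (\<Prod>i<N. 1 - q / w * q ^ i)) =
     K * (\<Sum>k\<le>2 * N. jterm \<tau> z (int k - int N) * qbinomial q (2 * N) k)"
    by (simp add: sum_distrib_left)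
  moreover have "K \<noteq> 0" by (simp add: K)
  ultimately show ?thesis by simp
qed

text \<open>The finite version passes to the limit by Tannery's theorem. Each Gaussian binomial is
  one \<open>qfac\<close> times two inverses, hence bounded uniformly, and tends to
  \<open>P * inverse P * inverse P = inverse P\<close>.\<close>

theorem jacobi_triple_product:
  fixes \<tau> z :: complex
  assumes "Im \<tau> > 0"
  defines "q \<equiv> exp (2 * of_real pi * \<i> * \<tau>)" and "w \<equiv> exp (2 * \<i> * z)"
  shows "(jterm \<tau> z has_sum (qpoch q q * qpoch w q * qpoch (q / w) q)) UNIV"
proof -
  have q: "norm q < 1" using assms by (simp add: q_def)
  define P where "P = qpoch q q"
  have P: "P \<noteq> 0" unfolding P_def using q by (intro qpoch_nonzero mult_power_neq_1)
  have lim: "qfac q \<longlonglongrightarrow> P"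
    using qpoch_LIMSEQ[OF q, of q] by (simp add: qfac_def[abs_def] P_def)
  have lim': "(\<lambda>n. inverse (qfac q n)) \<longlonglongrightarrow> inverse P"
    by (intro tendsto_inverse lim P)
  obtain B1 where B1: "\<And>n. norm (qfac q n) \<le> B1" "B1 > 0"
    using convergent_imp_Bseq[OF convergentI[OF lim]] by (auto simp: Bseq_def)
  obtain B2 where B2: "\<And>n. norm (inverse (qfac q n)) \<le> B2" "B2 > 0"
    using convergent_imp_Bseq[OF convergentI[OF lim']] by (auto simp: Bseq_def)
  \<comment> \<open>Extension by 0 makes the index set of the finite sum independent of
    \<open>N\<close>.\<close>
  define G where "G = (\<lambda>N (j::int). if \<bar>j\<bar> \<le> int N then qbinomial q (2 * N) (nat (j + int N)) else 0)"
  have G_eq: "G N j = qfac q (2 * N) * inverse (qfac q (nat (j + int N))) * inverse (qfac q (nat (int N - j)))"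
    if "\<bar>j\<bar> \<le> int N" for N j
  proof -
    have "nat (j + int N) \<le> 2 * N" "2 * N - nat (j + int N) = nat (int N - j)"
      using that by auto
    thus ?thesis using that by (simp add: G_def qbinomial_def divide_inverse)
  qed
  have G_bound: "norm (G N j) \<le> B1 * B2 * B2" for N j
  proof (cases "\<bar>j\<bar> \<le> int N")
    case True
    thus ?thesis unfolding G_eq[OF True] norm_mult
      by (intro mult_mono B1 B2) (use B1(2) B2(2) in auto)
  qed (use B1 B2 in \<open>auto simp: G_def\<close>)
  have G_lim: "(\<lambda>N. G N j) \<longlonglongrightarrow> inverse P" for j
  proof -
    have f1: "filterlim (\<lambda>N. nat (j + int N)) at_top sequentially"
      unfolding filterlim_at_top eventually_sequentially
    proof (intro allI exI impI)
      show "Z \<le> nat (j + int N)" if "Z + nat \<bar>j\<bar> \<le> N" for Z N using that by linarith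
    qed
    have f2: "filterlim (\<lambda>N. nat (int N - j)) at_top sequentially"
      unfolding filterlim_at_top eventually_sequentially
    proof (intro allI exI impI)
      show "Z \<le> nat (int N - j)" if "Z + nat \<bar>j\<bar> \<le> N" for Z N using that by linarith
    qed
    have f3: "filterlim (\<lambda>N. 2 * N :: nat) at_top sequentially"
      unfolding filterlim_at_top eventually_sequentially
    proof (intro allI exI impI)
      show "Z \<le> 2 * N" if "Z \<le> N" for Z N :: nat using that by linarith
    qed
    have "(\<lambda>N. qfac q (2 * N) * inverse (qfac q (nat (j + int N))) * inverse (qfac q (nat (int N - j))))
         \<longlonglongrightarrow> P * inverse P * inverse P"
      by (intro tendsto_mult filterlim_compose[OF lim f3] filterlim_compose[OF lim' f1]
            filterlim_compose[OF lim' f2])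
    moreover have "eventually (\<lambda>N. qfac q (2 * N) * inverse (qfac q (nat (j + int N))) * inverse (qfac q (nat (int N - j))) = G N j) sequentially"
      using eventually_ge_at_top[of "nat \<bar>j\<bar>"] by eventually_elim (auto simp: G_eq)
    ultimately show ?thesis using P by (simp add: tendsto_cong)
  qed
  let ?L = "\<lambda>N. (\<Prod>i<N. 1 - w * q ^ i) * (\<Prod>i<N. 1 - q / w * q ^ i)"
  have fin: "((\<lambda>j. jterm \<tau> z j * G N j) has_sum ?L N) UNIV" for N
  proof (rule has_sum_finite_neutralI)
    show "?L N = (\<Sum>j\<in>{- int N..int N}. jterm \<tau> z j * G N j)"
      unfolding q_def w_def finite_jacobi_triple_product[OF assms(1)]
      by (rule sum.reindex_bij_witness[where j = "\<lambda>k. int k - int N" and i = "\<lambda>j. nat (j + int N)"])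
         (auto simp: G_def q_def)
  qed (auto simp: G_def)
  \<comment> \<open>Folding \<open>j = k\<close> and \<open>j = - k - 1\<close> into one term gives
    a series over the naturals, the form in which Tannery's theorem applies.\<close>
  define a where "a = (\<lambda>k N. jterm \<tau> z (int k) * G N (int k) + jterm \<tau> z (- int k - 1) * G N (- int k - 1))"
  have a_sum: "suminf (\<lambda>k. a k N) = ?L N" for N
    using sums_unique[OF sums_fold_int[OF fin[of N]]] by (simp add: a_def)
  have summ: "jterm \<tau> z summable_on UNIV" by (rule jterm_summable[OF assms(1)])
  hence "(\<lambda>j. norm (jterm \<tau> z j)) summable_on UNIV"
    by (simp add: summable_on_iff_abs_summable_on_complex)
  then obtain S where "((\<lambda>j. norm (jterm \<tau> z j)) has_sum S) UNIV" by (auto simp: summable_on_def)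
  from sums_fold_int[OF this]
  have sm: "summable (\<lambda>k. (norm (jterm \<tau> z (int k)) + norm (jterm \<tau> z (- int k - 1))) * (B1 * B2 * B2))"
    by (intro summable_mult2) (auto simp: sums_iff)
  define b where "b = (\<lambda>k. jterm \<tau> z (int k) * inverse P + jterm \<tau> z (- int k - 1) * inverse P)"
  have "(\<lambda>N. suminf (\<lambda>k. a k N)) \<longlonglongrightarrow> suminf b"
  proof (rule tannerys_theorem[THEN conjunct2, THEN conjunct2, OF _ _ sm])
    show "(\<lambda>N. a k N) \<longlonglongrightarrow> b k" for k
      unfolding a_def b_def by (intro tendsto_intros G_lim)
    show "\<forall>\<^sub>F (k, n) in at_top \<times>\<^sub>F sequentially. norm (a k n) \<le>
        (norm (jterm \<tau> z (int k)) + norm (jterm \<tau> z (- int k - 1))) * (B1 * B2 * B2)"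
    proof (intro always_eventually allI, clarify)
      fix k N
      have "norm (a k N) \<le> norm (jterm \<tau> z (int k)) * norm (G N (int k)) + norm (jterm \<tau> z (- int k - 1)) * norm (G N (- int k - 1))"
        unfolding a_def norm_mult[symmetric] by (rule norm_triangle_ineq)
      also have "\<dots> \<le> norm (jterm \<tau> z (int k)) * (B1 * B2 * B2) + norm (jterm \<tau> z (- int k - 1)) * (B1 * B2 * B2)"
        by (intro add_mono mult_left_mono G_bound) auto
      finally show "norm (a k N) \<le> (norm (jterm \<tau> z (int k)) + norm (jterm \<tau> z (- int k - 1))) * (B1 * B2 * B2)"
        by (simp add: distrib_right)
    qed
  qed auto
  moreover have "(\<lambda>N. suminf (\<lambda>k. a k N)) \<longlonglongrightarrow> qpoch w q * qpoch (q / w) q"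
    unfolding a_sum by (intro tendsto_mult qpoch_LIMSEQ q)
  ultimately have "suminf b = qpoch w q * qpoch (q / w) q"
    by (rule LIMSEQ_unique)
  moreover obtain J where J: "(jterm \<tau> z has_sum J) UNIV" using summ by (auto simp: summable_on_def)
  have "b sums (J * inverse P)"
    using sums_mult2[OF sums_fold_int[OF J], of "inverse P"] by (simp add: b_def distrib_right)
  hence "suminf b = J * inverse P" by (simp add: sums_iff)
  ultimately have "J = P * qpoch w q * qpoch (q / w) q"
    using P by (simp add: field_simps)
  thus ?thesis using J by (simp add: P_def)
qed

section \<open>Spaces of theta functions\<close>

definition theta_term :: "complex \<Rightarrow> nat \<Rightarrow> complex \<Rightarrow> int \<Rightarrow> complex" where
  "theta_term T d x n = exp (of_real pi * \<i> * T * of_int n ^ 2 / (4 * of_nat d) + \<i> * of_int n * x)"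

text \<open>
  The Gaussian factor of a Fourier coefficient of a theta function of degree \<open>d\<close> is split off, so
  that the functional equation under \<open>x \<mapsto> x + \<pi>T\<close> becomes plain (twisted) periodicity of the
  remaining coefficients \<open>h\<close>; \<open>r\<close> is the parity of the frequencies that occur.
\<close>

definition theta_space :: "complex \<Rightarrow> nat \<Rightarrow> complex \<Rightarrow> int \<Rightarrow> (complex \<Rightarrow> complex) \<Rightarrow> bool" where
  "theta_space T d s r f \<longleftrightarrow> (\<exists>h. (\<forall>n. h (n + 2 * int d) = s * h n) \<and>
     (\<forall>n. odd (n - r) \<longrightarrow> h n = 0) \<and>
     (\<forall>x. ((\<lambda>n. h n * theta_term T d x n) has_sum f x) UNIV))"

lemma theta_spaceI:
  assumes "\<And>n. h (n + 2 * int d) = s * h n" "\<And>n. odd (n - r) \<Longrightarrow> h n = 0"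
    "\<And>x. ((\<lambda>n. h n * theta_term T d x n) has_sum f x) UNIV"
  shows "theta_space T d s r f"
  using assms unfolding theta_space_def by blast

lemma theta_spaceE:
  assumes "theta_space T d s r f"
  obtains h where "\<And>n. h (n + 2 * int d) = s * h n" "\<And>n. odd (n - r) \<Longrightarrow> h n = 0"
    "\<And>x. ((\<lambda>n. h n * theta_term T d x n) has_sum f x) UNIV"
  using assms unfolding theta_space_def by blast

lemma theta_space_parity:
  assumes "theta_space T d s r f" "even (r - r')"
  shows "theta_space T d s r' f"
proof -
  have "odd (n - r') \<longleftrightarrow> odd (n - r)" for n using assms(2) by presburger
  thus ?thesis using assms(1) unfolding theta_space_def by simp
qed

lemma theta_term_summable:
  assumes "Im T > 0" "d > 0" "\<And>n. norm (h n) \<le> B"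
  shows "(\<lambda>n. h n * theta_term T d x n) summable_on UNIV"
proof -
  have "(\<lambda>n. h n * exp (\<i> * (of_real (pi / (4 * real d)) * T) * of_int n ^ 2 + \<i> * of_int n * x)) summable_on UNIV"
    by (rule summable_on_theta_terms) (use assms in auto)
  thus ?thesis by (simp add: theta_term_def mult_ac)
qed

lemma theta_space_add:
  assumes "theta_space T d s r f" "theta_space T d s r g"
  shows "theta_space T d s r (\<lambda>x. f x + g x)"
proof -
  obtain h1 where h1: "\<And>n. h1 (n + 2 * int d) = s * h1 n" "\<And>n. odd (n - r) \<Longrightarrow> h1 n = 0"
    "\<And>x. ((\<lambda>n. h1 n * theta_term T d x n) has_sum f x) UNIV"
    using theta_spaceE[OF assms(1)] by blast
  obtain h2 where h2: "\<And>n. h2 (n + 2 * int d) = s * h2 n" "\<And>n. odd (n - r) \<Longrightarrow> h2 n = 0"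
    "\<And>x. ((\<lambda>n. h2 n * theta_term T d x n) has_sum g x) UNIV"
    using theta_spaceE[OF assms(2)] by blast
  show ?thesis
  proof (rule theta_spaceI[where h = "\<lambda>n. h1 n + h2 n"])
    show "((\<lambda>n. (h1 n + h2 n) * theta_term T d x n) has_sum f x + g x) UNIV" for x
      using has_sum_add[OF h1(3)[of x] h2(3)[of x]] by (simp add: distrib_right)
  qed (use h1 h2 in \<open>auto simp: distrib_left\<close>)
qed

lemma theta_space_cmult:
  assumes "theta_space T d s r f"
  shows "theta_space T d s r (\<lambda>x. c * f x)"
proof -
  obtain h where h: "\<And>n. h (n + 2 * int d) = s * h n" "\<And>n. odd (n - r) \<Longrightarrow> h n = 0"
    "\<And>x. ((\<lambda>n. h n * theta_term T d x n) has_sum f x) UNIV"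
    using theta_spaceE[OF assms] by blast
  show ?thesis
  proof (rule theta_spaceI[where h = "\<lambda>n. c * h n"])
    show "((\<lambda>n. c * h n * theta_term T d x n) has_sum c * f x) UNIV" for x
      using has_sum_cmult_right[OF h(3)[of x], of c] by (simp add: mult_ac)
  qed (use h in auto)
qed

lemma theta_space_uminus_arg:
  assumes "theta_space T d s r f" "s \<noteq> 0"
  shows "theta_space T d (1 / s) r (\<lambda>x. f (- x))"
proof -
  obtain h where h: "\<And>n. h (n + 2 * int d) = s * h n" "\<And>n. odd (n - r) \<Longrightarrow> h n = 0"
    "\<And>x. ((\<lambda>n. h n * theta_term T d x n) has_sum f x) UNIV"
    using theta_spaceE[OF assms(1)] by blast
  show ?thesis
  proof (rule theta_spaceI[where h = "\<lambda>n. h (- n)"])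
    show "((\<lambda>n. h (- n) * theta_term T d x n) has_sum f (- x)) UNIV" for x
    proof -
      have "((\<lambda>n. h (- n) * theta_term T d x n) has_sum f (- x)) UNIV \<longleftrightarrow>
            ((\<lambda>n. h n * theta_term T d (- x) n) has_sum f (- x)) UNIV"
        by (rule has_sum_reindex_bij_witness[where i = uminus and j = uminus])
           (auto simp: theta_term_def)
      thus ?thesis using h(3) by simp
    qed
    show "h (- (n + 2 * int d)) = 1 / s * h (- n)" for n
      using h(1)[of "- n - 2 * int d"] assms(2) by (simp add: field_simps)
    show "h (- n) = 0" if "odd (n - r)" for n
      using that by (intro h(2)) auto
  qed
qed

lemma theta_space_shift:
  assumes "theta_space T d s r f"
  shows "theta_space T d (s * exp (2 * \<i> * of_nat d * y)) r (\<lambda>x. f (x + y))"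
proof -
  obtain h where h: "\<And>n. h (n + 2 * int d) = s * h n" "\<And>n. odd (n - r) \<Longrightarrow> h n = 0"
    "\<And>x. ((\<lambda>n. h n * theta_term T d x n) has_sum f x) UNIV"
    using theta_spaceE[OF assms] by blast
  show ?thesis
  proof (rule theta_spaceI[where h = "\<lambda>n. h n * exp (\<i> * of_int n * y)"])
    show "((\<lambda>n. h n * exp (\<i> * of_int n * y) * theta_term T d x n) has_sum f (x + y)) UNIV" for x
      using h(3)[of "x + y"]
      by (simp add: theta_term_def mult.assoc exp_add[symmetric] distrib_left add_ac)
  qed (use h in \<open>auto simp: exp_add algebra_simps\<close>)
qed

text \<open>Completing the square: the factor \<open>exp (\<i> * j * x)\<close> together with a
  shift by \<open>j / (2 * d)\<close> of the quasi-period \<open>pi * T\<close> relabels frequency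
  \<open>n\<close> as \<open>n + j\<close>, at the cost of the constant \<open>K\<close>. With
  \<open>d = 5\<close>, \<open>T = 5 * \<tau>\<close> and \<open>j = 2, 4\<close> this explains the
  exponentials that accompany the shifts by \<open>pi * \<tau>\<close> and
  \<open>2 * pi * \<tau>\<close> in the theorem.\<close>

lemma theta_space_quasi_shift:
  assumes "theta_space T d s r f" "d > 0"
  shows "theta_space T d s (r + j) (\<lambda>x. exp (\<i> * of_int j * x) * f (x + of_real pi * T * of_int j / (2 * of_nat d)))"
proof -
  obtain h where h: "\<And>n. h (n + 2 * int d) = s * h n" "\<And>n. odd (n - r) \<Longrightarrow> h n = 0"
    "\<And>x. ((\<lambda>n. h n * theta_term T d x n) has_sum f x) UNIV"
    using theta_spaceE[OF assms(1)] by blast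
  define K where "K = exp (- of_real pi * \<i> * T * of_int j ^ 2 / (4 * of_nat d))"
  show ?thesis
  proof (rule theta_spaceI[where h = "\<lambda>n. h (n - j) * K"])
    fix x
    let ?x = "x + of_real pi * T * of_int j / (2 * of_nat d)"
    have *: "exp (\<i> * of_int j * x) * theta_term T d ?x n = K * theta_term T d x (n + j)" for n
      unfolding theta_term_def K_def exp_add[symmetric] using assms(2)
      by (intro arg_cong[where f = exp]) (simp add: field_simps power2_eq_square)
    have "((\<lambda>n. exp (\<i> * of_int j * x) * (h n * theta_term T d ?x n)) has_sum exp (\<i> * of_int j * x) * f ?x) UNIV"
      by (intro has_sum_cmult_right h)
    hence "((\<lambda>n. h n * K * theta_term T d x (n + j)) has_sum exp (\<i> * of_int j * x) * f ?x) UNIV"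
      using * by (simp add: mult_ac)
    also have "?this \<longleftrightarrow> ((\<lambda>n. h (n - j) * K * theta_term T d x n) has_sum exp (\<i> * of_int j * x) * f ?x) UNIV"
      by (rule has_sum_reindex_bij_witness[where i = "\<lambda>n. n - j" and j = "\<lambda>n. n + j"]) auto
    finally show "((\<lambda>n. h (n - j) * K * theta_term T d x n) has_sum exp (\<i> * of_int j * x) * f ?x) UNIV" .
  next
    show "h (n + 2 * int d - j) * K = s * (h (n - j) * K)" for n
      using h(1)[of "n - j"] by (simp add: algebra_simps)
  next
    show "h (n - j) * K = 0" if "odd (n - (r + j))" for n
      using that h(2)[of "n - j"] by (simp add: algebra_simps)
  qed
qed

text \<open>A Cauchy product combined with \<open>k\<^sup>2/d + l\<^sup>2/d' = (k+l)\<^sup>2/(d+d')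
  + (d'k - dl)\<^sup>2/(dd'(d+d'))\<close>. The last square stays in the coefficient as
  \<open>E\<close>. It is unchanged when \<open>k\<close> grows by \<open>2d\<close> and
  \<open>l\<close> by \<open>2d'\<close>, which makes the new coefficients twisted periodic with
  multiplier \<open>s * s'\<close>.\<close>

lemma theta_space_mult:
  assumes "theta_space T d s r f" "theta_space T d' s' r' g" "d > 0" "d' > 0"
  shows "theta_space T (d + d') (s * s') (r + r') (\<lambda>x. f x * g x)"
proof -
  obtain h where h: "\<And>n. h (n + 2 * int d) = s * h n" "\<And>n. odd (n - r) \<Longrightarrow> h n = 0"
    "\<And>x. ((\<lambda>n. h n * theta_term T d x n) has_sum f x) UNIV"
    using theta_spaceE[OF assms(1)] by blast
  obtain h' where h': "\<And>n. h' (n + 2 * int d') = s' * h' n" "\<And>n. odd (n - r') \<Longrightarrow> h' n = 0"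
    "\<And>x. ((\<lambda>n. h' n * theta_term T d' x n) has_sum g x) UNIV"
    using theta_spaceE[OF assms(2)] by blast
  define D :: complex where "D = 4 * of_nat d * of_nat d' * (of_nat d + of_nat d')"
  define E where "E = (\<lambda>n k :: int. exp (of_real pi * \<i> * T * (of_nat d' * of_int k - of_nat d * of_int (n - k)) ^ 2 / D))"
  define w where "w = (\<lambda>n k. h k * h' (n - k) * E n k)"
  have dnz: "(of_nat d :: complex) \<noteq> 0" "(of_nat d' :: complex) \<noteq> 0" "of_nat d + of_nat d' \<noteq> (0 :: complex)"
    using assms(3,4) by (auto simp: of_nat_add[symmetric] simp del: of_nat_add)
  have term_eq: "theta_term T d x k * theta_term T d' x (n - k) = E n k * theta_term T (d + d') x n" for n k x
  proof -
    have "of_int k ^ 2 / of_nat d + of_int (n - k) ^ 2 / of_nat d' - of_int n ^ 2 / (of_nat d + of_nat d') =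
       4 * ((of_nat d' * of_int k - of_nat d * of_int (n - k)) ^ 2 / D :: complex)"
      unfolding D_def using dnz
      by (simp add: divide_simps) (simp add: algebra_simps power2_eq_square)
    hence "of_real pi * \<i> * T / 4 * (of_int k ^ 2 / of_nat d + of_int (n - k) ^ 2 / of_nat d') =
       of_real pi * \<i> * T / 4 * (4 * ((of_nat d' * of_int k - of_nat d * of_int (n - k)) ^ 2 / D) + of_int n ^ 2 / (of_nat d + of_nat d'))"
      by (simp add: algebra_simps)
    thus ?thesis
      unfolding theta_term_def E_def exp_add[symmetric]
      by (intro arg_cong[where f = exp]) (simp add: algebra_simps)
  qed
  have prod: "((\<lambda>(n, k). w n k * theta_term T (d + d') x n) has_sum f x * g x) (UNIV \<times> UNIV)" for x
  proof -
    let ?F = "\<lambda>k. h k * theta_term T d x k" and ?G = "\<lambda>k. h' k * theta_term T d' x k"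
    have "(\<lambda>k. norm (?F k)) summable_on UNIV" "(\<lambda>k. norm (?G k)) summable_on UNIV"
      using h(3)[of x] h'(3)[of x]
      unfolding summable_on_iff_abs_summable_on_complex[symmetric] by (auto intro: has_sum_imp_summable)
    then obtain a b where a: "((\<lambda>k. norm (?F k)) has_sum a) UNIV" and b: "((\<lambda>k. norm (?G k)) has_sum b) UNIV"
      unfolding summable_on_def by blast
    have "(\<lambda>(k, l). norm (?F k) * norm (?G l)) summable_on (UNIV \<times> UNIV)"
      by (rule summable_on_SigmaI[where g = "\<lambda>k. norm (?F k) * b"])
         (auto intro!: has_sum_cmult_right summable_on_cmult_left b has_sum_imp_summable[OF a])
    hence "(\<lambda>(k, l). ?F k * ?G l) summable_on (UNIV \<times> UNIV)"
      by (subst summable_on_iff_abs_summable_on_complex) (simp add: norm_mult case_prod_unfold)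
    hence "((\<lambda>(k, l). ?F k * ?G l) has_sum f x * g x) (UNIV \<times> UNIV)"
      by (intro has_sum_SigmaI[where g = "\<lambda>k. ?F k * g x"])
         (auto intro!: has_sum_cmult_right has_sum_cmult_left h(3) h'(3))
    also have "?this \<longleftrightarrow> ((\<lambda>(n, k). w n k * theta_term T (d + d') x n) has_sum f x * g x) (UNIV \<times> UNIV)"
    proof (rule has_sum_reindex_bij_witness[where i = "\<lambda>(n, k). (k, n - k)" and j = "\<lambda>(k, l). (k + l, k)"])
      fix a :: "int \<times> int" assume "a \<in> UNIV \<times> UNIV"
      obtain k l where a: "a = (k, l)" by (cases a)
      show "(case case a of (k, l) \<Rightarrow> (k + l, k) of (n, k) \<Rightarrow> w n k * theta_term T (d + d') x n) =
         (case a of (k, l) \<Rightarrow> ?F k * ?G l)"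
        using term_eq[of x k "k + l"] unfolding a by (simp add: w_def mult_ac)
    qed auto
    finally show ?thesis .
  qed
  have w_summable: "w n summable_on UNIV" for n
  proof -
    \<comment> \<open>The double series converges at \<open>x = 0\<close>, where
      \<open>theta_term\<close> is a nonzero factor independent of \<open>k\<close>.\<close>
    have "(\<lambda>(n, k). w n k * theta_term T (d + d') 0 n) summable_on UNIV \<times> UNIV"
      using prod[of 0] by (rule has_sum_imp_summable)
    hence "(\<lambda>k. w n k * theta_term T (d + d') 0 n) summable_on UNIV"
      by (rule summable_on_SigmaD1) auto
    moreover have "theta_term T (d + d') 0 n \<noteq> 0" by (simp add: theta_term_def)
    ultimately show ?thesis by (simp add: summable_on_cmult_left')
  qed
  show ?thesis
  proof (rule theta_spaceI[where h = "\<lambda>n. infsum (w n) UNIV"])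
    show "((\<lambda>n. infsum (w n) UNIV * theta_term T (d + d') x n) has_sum f x * g x) UNIV" for x
      by (rule has_sum_SigmaD[OF prod]) (auto intro!: has_sum_cmult_left has_sum_infsum w_summable)
  next
    fix n
    have "infsum (w (n + 2 * int (d + d'))) UNIV = infsum (\<lambda>k. w (n + 2 * int (d + d')) (k + 2 * int d)) UNIV"
      by (rule infsum_reindex_bij_witness[where i = "\<lambda>k. k + 2 * int d" and j = "\<lambda>k. k - 2 * int d"]) auto
    also have "(\<lambda>k. w (n + 2 * int (d + d')) (k + 2 * int d)) = (\<lambda>k. s * s' * w n k)"
    proof
      fix k
      have "E (n + 2 * int (d + d')) (k + 2 * int d) = E n k"
        unfolding E_def
        by (intro arg_cong[where f = "\<lambda>x. exp (_ * x ^ 2 / _)"]) (simp add: algebra_simps)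
      moreover have "h' (n + 2 * int (d + d') - (k + 2 * int d)) = s' * h' (n - k)"
        using h'(1)[of "n - k"] by (simp add: algebra_simps)
      ultimately show "w (n + 2 * int (d + d')) (k + 2 * int d) = s * s' * w n k"
        by (simp add: w_def h(1))
    qed
    also have "infsum \<dots> UNIV = s * s' * infsum (w n) UNIV"
      by (rule infsum_cmult_right')
    finally show "infsum (w (n + 2 * int (d + d'))) UNIV = s * s' * infsum (w n) UNIV" .
  next
    fix n assume n: "odd (n - (r + r'))"
    have "w n k = 0" for k
    proof (cases "odd (k - r)")
      case False
      hence "odd (n - k - r')" using n by presburger
      thus ?thesis using h'(2) by (simp add: w_def)
    qed (use h(2) in \<open>auto simp: w_def\<close>)
    thus "infsum (w n) UNIV = 0" by (intro infsum_0) auto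
  qed
qed

lemma twisted_periodic_eq_0:
  fixes h :: "int \<Rightarrow> complex"
  assumes "\<And>n. h (n + D) = s * h n" "s \<noteq> 0" "\<And>n. n \<in> {0..<D} \<Longrightarrow> h n = 0" "D > 0"
  shows "h n = 0"
proof -
  have pos: "h (m + D * int k) = s ^ k * h m" for k m
  proof (induction k)
    case (Suc k)
    thus ?case using assms(1)[of "m + D * int k"] by (simp add: algebra_simps)
  qed auto
  have 0: "h (n mod D) = 0" using assms(4) by (intro assms(3)) auto
  show ?thesis
  proof (cases "n div D \<ge> 0")
    case True
    thus ?thesis using pos[of "n mod D" "nat (n div D)"] 0 by simp
  next
    case False
    \<comment> \<open>For a negative quotient the recursion runs upwards from \<open>n\<close> to
      its residue, and the power of \<open>s\<close> is cancelled.\<close>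
    hence "n + D * int (nat (- (n div D))) = n mod D"
      by (simp add: minus_div_mult_eq_mod[symmetric] algebra_simps)
    thus ?thesis using pos[of n "nat (- (n div D))"] 0 assms(2) by simp
  qed
qed

section \<open>The function theta1\<close>

lemma jterm_quasi_period:
  "jterm T (z + of_real pi * T) n = - exp (- 2 * \<i> * z) * jterm T z (n + 1)"
proof -
  have "exp (of_real pi * \<i> * T * of_int (n * (n - 1)) + 2 * \<i> * of_int n * (z + of_real pi * T)) =
     exp (- 2 * \<i> * z) * exp (of_real pi * \<i> * T * of_int ((n + 1) * (n + 1 - 1)) + 2 * \<i> * of_int (n + 1) * z)"
    unfolding exp_add[symmetric] by (intro arg_cong[where f = exp]) (simp add: algebra_simps)
  thus ?thesis unfolding jterm_def by (simp add: power_int_add)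
qed

text \<open>Moving the argument by \<open>pi * T\<close> turns \<open>n(n-1)\<close> into
  \<open>n(n+1)\<close>, and the prefactor completes this to \<open>(2n+1)\<^sup>2/4\<close>. The
  terms at \<open>n\<close> and \<open>-n-1\<close> have opposite frequencies and opposite signs, so
  they combine to twice a sine term.\<close>

lemma theta1_jterm:
  assumes "Im T > 0"
  shows "((\<lambda>n. - \<i> * exp (of_real pi * \<i> * T / 4 + \<i> * z) * jterm T (z + of_real pi * T) n) has_sum theta1 z T) UNIV"
    (is "(?f has_sum _) _")
proof -
  have f: "?f n = - \<i> * (-1) powi n * exp (of_real pi * \<i> * T * (2 * of_int n + 1) ^ 2 / 4 + \<i> * (2 * of_int n + 1) * z)" for n
  proof -
    have "exp (of_real pi * \<i> * T * (2 * of_int n + 1) ^ 2 / 4 + \<i> * (2 * of_int n + 1) * z) =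
       exp (of_real pi * \<i> * T / 4 + \<i> * z) *
       exp (of_real pi * \<i> * T * of_int (n * (n - 1)) + 2 * \<i> * of_int n * (z + of_real pi * T))"
      unfolding exp_add[symmetric]
      by (intro arg_cong[where f = exp]) (simp add: field_simps power2_eq_square)
    thus ?thesis by (simp add: jterm_def)
  qed
  have "?f summable_on UNIV"
    by (intro summable_on_cmult_right jterm_summable assms)
  then obtain S where S: "(?f has_sum S) UNIV" unfolding summable_on_def by blast
  let ?g = "\<lambda>n. (- 1) ^ n * qpow T ((2 * real n + 1) ^ 2 / 8) * sin ((2 * of_nat n + 1) * z)"
  have "?f (int n) + ?f (- int n - 1) = 2 * ?g n" for n
  proof -
    define E where "E = exp (of_real pi * \<i> * T * (2 * of_nat n + 1) ^ 2 / 4)"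
    have E: "qpow T ((2 * real n + 1) ^ 2 / 8) = E"
      unfolding E_def qpow_def by (intro arg_cong[where f = exp]) (simp add: field_simps)
    have "(-1 :: complex) powi (- int n - 1) = - ((-1) ^ n)"
      by (cases "even n") (simp_all add: power_int_diff power_int_minus)
    moreover have "(2 * complex_of_int (- int n - 1) + 1) = - (2 * of_nat n + 1)"
      by simp
    ultimately have "?f (- int n - 1) = \<i> * (-1) ^ n * (E * exp (- (\<i> * ((2 * of_nat n + 1) * z))))"
      unfolding f E_def exp_add[symmetric]
      by (simp add: algebra_simps power2_eq_square)
    moreover have "?f (int n) = - \<i> * (-1) ^ n * (E * exp (\<i> * ((2 * of_nat n + 1) * z)))"
      unfolding f E_def exp_add[symmetric] by (simp add: algebra_simps)
    ultimately show ?thesis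
      unfolding E sin_exp_eq by (simp add: field_simps)
  qed
  with sums_fold_int[OF S] have "(\<lambda>n. 2 * ?g n) sums S" by simp
  hence "(\<lambda>n. (1/2) * (2 * ?g n)) sums ((1/2) * S)" by (rule sums_mult)
  hence "?g sums (S / 2)" by simp
  hence "suminf ?g = S / 2" by (rule sums_unique[symmetric])
  hence "theta1 z T = S" unfolding theta1_def by (simp only:) simp
  thus ?thesis using S by simp
qed

lemma theta1_product:
  fixes T z :: complex
  assumes "Im T > 0"
  defines "q \<equiv> exp (2 * of_real pi * \<i> * T)" and "w \<equiv> exp (2 * \<i> * z)"
  shows "theta1 z T = - \<i> * exp (of_real pi * \<i> * T / 4 + \<i> * z) * (qpoch q q * qpoch (w * q) q * qpoch (1 / w) q)"
proof -
  have "exp (2 * \<i> * (z + of_real pi * T)) = w * q"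
    unfolding w_def q_def exp_add[symmetric] by (simp add: algebra_simps)
  moreover have "q / (w * q) = 1 / w" by (simp add: q_def)
  ultimately have "(jterm T (z + of_real pi * T) has_sum (qpoch q q * qpoch (w * q) q * qpoch (1 / w) q)) UNIV"
    using jacobi_triple_product[OF assms(1), of "z + of_real pi * T"] by (simp add: q_def)
  from has_sum_cmult_right[OF this, of "- \<i> * exp (of_real pi * \<i> * T / 4 + \<i> * z)"] theta1_jterm[OF assms(1), of z]
  show ?thesis by (rule has_sum_unique[rotated])
qed

lemma theta1_quasi_period:
  assumes "Im T > 0"
  shows "theta1 (z + of_real pi * T) T = - exp (- of_real pi * \<i> * T - 2 * \<i> * z) * theta1 z T"
proof -
  let ?Z = "z + of_real pi * T"
  have e: "exp (of_real pi * \<i> * T / 4 + \<i> * ?Z) * exp (- 2 * \<i> * ?Z) =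
      exp (- of_real pi * \<i> * T - 2 * \<i> * z) * exp (of_real pi * \<i> * T / 4 + \<i> * z)"
    unfolding exp_add[symmetric] by (intro arg_cong[where f = exp]) (simp add: algebra_simps)
  have "((\<lambda>n. - exp (- of_real pi * \<i> * T - 2 * \<i> * z) * (- \<i> * exp (of_real pi * \<i> * T / 4 + \<i> * z) * jterm T ?Z n))
          has_sum - exp (- of_real pi * \<i> * T - 2 * \<i> * z) * theta1 z T) UNIV"
    by (intro has_sum_cmult_right theta1_jterm assms)
  also have "?this \<longleftrightarrow> ((\<lambda>n. - \<i> * exp (of_real pi * \<i> * T / 4 + \<i> * ?Z) * jterm T (?Z + of_real pi * T) n)
          has_sum - exp (- of_real pi * \<i> * T - 2 * \<i> * z) * theta1 z T) UNIV"
  proof (rule has_sum_reindex_bij_witness[where i = "\<lambda>n. n + 1" and j = "\<lambda>n. n - 1"])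
    fix n :: int
    have "- \<i> * exp (of_real pi * \<i> * T / 4 + \<i> * ?Z) * jterm T (?Z + of_real pi * T) (n - 1) =
          \<i> * (exp (of_real pi * \<i> * T / 4 + \<i> * ?Z) * exp (- 2 * \<i> * ?Z)) * jterm T ?Z n"
      unfolding jterm_quasi_period by simp
    thus "- \<i> * exp (of_real pi * \<i> * T / 4 + \<i> * ?Z) * jterm T (?Z + of_real pi * T) (n - 1) =
       - exp (- of_real pi * \<i> * T - 2 * \<i> * z) * (- \<i> * exp (of_real pi * \<i> * T / 4 + \<i> * z) * jterm T ?Z n)"
      unfolding e by simp
  qed auto
  finally show ?thesis
    using theta1_jterm[OF assms, of ?Z] by (rule has_sum_unique[rotated])
qed

definition theta1_coeff :: "int \<Rightarrow> complex" where
  "theta1_coeff n = (if odd n then - \<i> * (-1) powi (n div 2) else 0)"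

lemma theta1_has_sum:
  assumes "Im T > 0"
  shows "((\<lambda>n. theta1_coeff n * theta_term T 1 z n) has_sum theta1 z T) UNIV"
proof -
  have "((\<lambda>n. - \<i> * exp (of_real pi * \<i> * T / 4 + \<i> * z) * jterm T (z + of_real pi * T) n) has_sum theta1 z T) UNIV"
    by (rule theta1_jterm[OF assms])
  also have "?this \<longleftrightarrow> ((\<lambda>n. theta1_coeff n * theta_term T 1 z n) has_sum theta1 z T) {n. odd n}"
  proof (rule has_sum_reindex_bij_witness[where i = "\<lambda>n. n div 2" and j = "\<lambda>n. 2 * n + 1"])
    fix n :: int
    have "theta_term T 1 z (2 * n + 1) = exp (of_real pi * \<i> * T / 4 + \<i> * z) *
       exp (of_real pi * \<i> * T * of_int (n * (n - 1)) + 2 * \<i> * of_int n * (z + of_real pi * T))"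
      unfolding exp_add[symmetric] theta_term_def
      by (intro arg_cong[where f = exp]) (simp add: field_simps power2_eq_square)
    thus "theta1_coeff (2 * n + 1) * theta_term T 1 z (2 * n + 1) =
        - \<i> * exp (of_real pi * \<i> * T / 4 + \<i> * z) * jterm T (z + of_real pi * T) n"
      by (simp add: theta1_coeff_def jterm_def)
  qed auto
  also have "\<dots> \<longleftrightarrow> ((\<lambda>n. theta1_coeff n * theta_term T 1 z n) has_sum theta1 z T) UNIV"
    by (rule has_sum_cong_neutral) (auto simp: theta1_coeff_def)
  finally show ?thesis .
qed

lemma theta1_coeff_add_2: "theta1_coeff (n + 2) = - theta1_coeff n"
  by (simp add: theta1_coeff_def power_int_add)

lemma theta1_coeff_uminus: "theta1_coeff (- n) = - theta1_coeff n"
proof (cases "odd n")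
  case True
  then obtain k where "n = 2 * k + 1" by (elim oddE)
  moreover have "(- (2 * k) - 1) div 2 = - k - 1" by presburger
  moreover have "(-1 :: complex) powi (- k - 1) = - ((-1) powi k)"
    by (cases "even k") (auto simp: power_int_diff power_int_minus)
  ultimately show ?thesis by (simp add: theta1_coeff_def)
qed (simp add: theta1_coeff_def)

lemma theta_space_theta1:
  assumes "Im T > 0"
  shows "theta_space T 1 (-1) 1 (\<lambda>x. theta1 x T)"
proof (rule theta_spaceI[where h = theta1_coeff])
  show "theta1_coeff n = 0" if "odd (n - 1)" for n using that by (simp add: theta1_coeff_def)
qed (simp_all only: theta1_coeff_add_2 theta1_has_sum[OF assms] of_nat_1 mult_1 mult_1_right mult_minus_left)

lemma theta1_minus:
  assumes "Im T > 0"
  shows "theta1 (- z) T = - theta1 z T"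
proof -
  have "((\<lambda>n. - (theta1_coeff n * theta_term T 1 z n)) has_sum - theta1 z T) UNIV"
    by (intro has_sum_uminusI theta1_has_sum assms)
  also have "?this \<longleftrightarrow> ((\<lambda>n. theta1_coeff n * theta_term T 1 (- z) n) has_sum - theta1 z T) UNIV"
    by (rule has_sum_reindex_bij_witness[where i = uminus and j = uminus])
       (auto simp: theta_term_def theta1_coeff_uminus)
  finally show ?thesis using theta1_has_sum[OF assms, of "- z"] by (rule has_sum_unique[rotated])
qed

lemma exp_int_pi_i: "exp (of_int n * (of_real pi * \<i>)) = (-1 :: complex) powi n"
  by (simp add: exp_power_int[symmetric])

lemma theta1_add_pi:
  assumes "Im T > 0"
  shows "theta1 (z + of_real pi) T = - theta1 z T"
proof -
  have "((\<lambda>n. - (theta1_coeff n * theta_term T 1 z n)) has_sum - theta1 z T) UNIV"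
    by (intro has_sum_uminusI theta1_has_sum assms)
  also have "(\<lambda>n. - (theta1_coeff n * theta_term T 1 z n)) = (\<lambda>n. theta1_coeff n * theta_term T 1 (z + of_real pi) n)"
  proof
    fix n
    have "theta_term T 1 (z + of_real pi) n = theta_term T 1 z n * exp (of_int n * (of_real pi * \<i>))"
      unfolding theta_term_def exp_add[symmetric] by (intro arg_cong[where f = exp]) (simp add: algebra_simps)
    thus "- (theta1_coeff n * theta_term T 1 z n) = theta1_coeff n * theta_term T 1 (z + of_real pi) n"
      unfolding exp_int_pi_i by (simp add: theta1_coeff_def)
  qed
  finally show ?thesis using theta1_has_sum[OF assms, of "z + of_real pi"] by (rule has_sum_unique[rotated])
qed

text \<open>The exponents are odd squares over 8, so the translation multiplies each term by a power
  of \<open>exp (2 * pi * \<i>)\<close>.\<close>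

lemma theta1_add_8_int: "theta1 z (T + 8 * of_int k) = theta1 z T"
proof -
  have "qpow (T + 8 * of_int k) ((2 * real n + 1) ^ 2 / 8) = qpow T ((2 * real n + 1) ^ 2 / 8)" for n
  proof -
    have "qpow (T + 8 * of_int k) ((2 * real n + 1) ^ 2 / 8) =
        qpow T ((2 * real n + 1) ^ 2 / 8) * exp (of_int (2 * (2 * int n + 1) ^ 2 * k) * (of_real pi * \<i>))"
      unfolding qpow_def exp_add[symmetric]
      by (intro arg_cong[where f = exp]) (simp add: field_simps)
    thus ?thesis unfolding exp_int_pi_i by simp
  qed
  thus ?thesis by (simp add: theta1_def)
qed

lemma theta1_add_2_pi_nat:
  assumes "Im T > 0"
  shows "theta1 (z + 2 * of_real pi * of_nat k) T = theta1 z T"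
proof (induction k)
  case (Suc k)
  have "z + 2 * of_real pi * of_nat (Suc k) = z + 2 * of_real pi * of_nat k + of_real pi + of_real pi"
    by (simp add: algebra_simps)
  thus ?case using Suc by (simp only: theta1_add_pi[OF assms]) simp
qed simp

section \<open>The Dedekind eta function and the pentagonal number series\<close>

text \<open>The factors are sorted by their index modulo \<open>m\<close>: for the first
  \<open>N * m\<close> factors this is a finite regrouping, and both sides converge along this
  subsequence.\<close>

lemma qpoch_dissection:
  assumes "norm q < 1" "m > 0"
  shows "qpoch w q = (\<Prod>j<m. qpoch (w * q ^ j) (q ^ m))"
proof -
  have qm: "norm (q ^ m) < 1"
    using assms by (simp add: norm_power power_less_one_iff)
  have "(\<lambda>N. \<Prod>j<m. \<Prod>n<N. 1 - w * q ^ j * (q ^ m) ^ n) \<longlonglongrightarrow> (\<Prod>j<m. qpoch (w * q ^ j) (q ^ m))"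
    by (intro tendsto_prod qpoch_LIMSEQ qm)
  also have "(\<lambda>N. \<Prod>j<m. \<Prod>n<N. 1 - w * q ^ j * (q ^ m) ^ n) = (\<lambda>N. \<Prod>n<N * m. 1 - w * q ^ n)"
  proof
    fix N
    have "(\<Prod>j<m. \<Prod>n<N. 1 - w * q ^ j * (q ^ m) ^ n) = (\<Prod>n<N. \<Prod>j<m. 1 - w * q ^ (n * m + j))"
      unfolding prod.swap[of _ "{..<N}" "{..<m}"]
      by (intro prod.cong refl) (simp add: power_add power_mult[symmetric] mult_ac)
    also have "\<dots> = (\<Prod>n<N. \<Prod>k\<in>{n * m..<n * m + m}. 1 - w * q ^ k)"
    proof (rule prod.cong[OF refl])
      fix n
      show "(\<Prod>j<m. 1 - w * q ^ (n * m + j)) = (\<Prod>k\<in>{n * m..<n * m + m}. 1 - w * q ^ k)"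
        by (rule prod.reindex_bij_witness[where i = "\<lambda>k. k - n * m" and j = "\<lambda>j. n * m + j"]) auto
    qed
    also have "\<dots> = (\<Prod>n<N * m. 1 - w * q ^ n)" by (rule prod.nat_group)
    finally show "(\<Prod>j<m. \<Prod>n<N. 1 - w * q ^ j * (q ^ m) ^ n) = (\<Prod>n<N * m. 1 - w * q ^ n)" .
  qed
  finally have "(\<lambda>N. \<Prod>n<N * m. 1 - w * q ^ n) \<longlonglongrightarrow> (\<Prod>j<m. qpoch (w * q ^ j) (q ^ m))" .
  moreover have "(\<lambda>N. \<Prod>n<N * m. 1 - w * q ^ n) \<longlonglongrightarrow> qpoch w q"
    by (rule filterlim_compose[OF qpoch_LIMSEQ[OF assms(1)]])
       (use assms(2) in \<open>auto intro!: filterlim_subseq simp: strict_mono_def\<close>)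
  ultimately show ?thesis by (rule LIMSEQ_unique[rotated])
qed

lemma dedekind_eta_qpoch:
  "dedekind_eta \<tau> = exp (of_real pi * \<i> * \<tau> / 12) *
     qpoch (exp (2 * of_real pi * \<i> * \<tau>)) (exp (2 * of_real pi * \<i> * \<tau>))"
proof -
  have "qpow \<tau> (real (Suc n)) = exp (2 * of_real pi * \<i> * \<tau>) * exp (2 * of_real pi * \<i> * \<tau>) ^ n" for n
    unfolding qpow_def exp_of_nat_mult[symmetric] exp_add[symmetric]
    by (intro arg_cong[where f = exp]) (simp add: algebra_simps)
  moreover have "qpow \<tau> (1 / 24) = exp (of_real pi * \<i> * \<tau> / 12)"
    by (simp add: qpow_def mult_ac)
  ultimately show ?thesis unfolding dedekind_eta_def qpoch_def by simp
qed

lemma dedekind_eta_nonzero: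
  assumes "Im \<tau> > 0"
  shows "dedekind_eta \<tau> \<noteq> 0"
proof -
  have "norm (exp (2 * of_real pi * \<i> * \<tau>)) < 1" using assms by simp
  thus ?thesis unfolding dedekind_eta_qpoch by (simp add: qpoch_nonzero mult_power_neq_1 del: norm_exp_eq_Re)
qed

text \<open>
  The Kronecker symbol \<open>(12/n)\<close>.
\<close>

definition chi12 :: "int \<Rightarrow> complex" where
  "chi12 n = (if n mod 6 = 1 then (-1) powi (n div 6) else if n mod 6 = 5 then (-1) powi (n div 6 + 1) else 0)"

lemma chi12_add_6: "chi12 (n + 6) = - chi12 n"
  by (simp add: chi12_def power_int_add)

lemma chi12_uminus: "chi12 (- n) = chi12 n"
proof -
  have "(-1 :: complex) powi (- k) = (-1) powi k" for k
    by (cases "even k") (simp_all add: power_int_minus)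
  moreover have "(-1 :: complex) powi (- k - 1) = (-1) powi (k + 1)" for k
    by (cases "even k") (simp_all add: power_int_minus power_int_diff power_int_add)
  ultimately show ?thesis
    by (simp add: chi12_def zmod_zminus1_eq_if zdiv_zminus1_eq_if)
qed

lemma chi12_add_12_mult: "chi12 (n + 12 * k) = chi12 n"
proof -
  have "(n + 12 * k) mod 6 = n mod 6" "(n + 12 * k) div 6 = n div 6 + 2 * k"
    using mod_mult_self2[of n 6 "2 * k"] div_mult_self2[of 6 n "2 * k"] by simp_all
  thus ?thesis by (simp add: chi12_def power_int_add)
qed

lemma chi12_even:
  assumes "even n"
  shows "chi12 n = 0"
proof -
  obtain k where "n = 2 * k" using assms by (elim evenE)
  hence *: "n mod 6 = 2 * (k mod 3)" using mod_mult_mult1[of 2 k 3] by simp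
  have "2 * x \<noteq> 1" "2 * x \<noteq> 5" for x :: int by presburger+
  thus ?thesis unfolding chi12_def * by simp
qed

text \<open>The value of the symbol at 5 is -1. Concretely, \<open>5n = -n + 6 + 12k\<close> for
  \<open>n = 2k + 1\<close>, and of these changes only the 6 affects the sign.\<close>

lemma chi12_mult_5: "chi12 (5 * n) = - chi12 n"
proof (cases "even n")
  case False
  then obtain k where k: "n = 2 * k + 1" by (elim oddE)
  have "5 * n = (- n + 6) + 12 * k" by (simp add: k)
  thus ?thesis by (simp only: chi12_add_12_mult chi12_add_6 chi12_uminus)
qed (simp add: chi12_even)

lemma chi12_6_mult_add_1: "chi12 (6 * m + 1) = (-1) powi m"
  by (simp add: chi12_def)

lemma norm_chi12_le: "norm (chi12 n) \<le> 1"
  by (simp add: chi12_def norm_power_int)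

text \<open>
  The series side of the quintuple product identity, normalised so that its value at \<open>\<pi>/3\<close> is
  \<open>\<eta>(T)\<close>.
\<close>

definition quint :: "complex \<Rightarrow> complex \<Rightarrow> complex" where
  "quint T x = (\<Sum>\<^sub>\<infinity>n. chi12 n * theta_term T 3 x n)"

lemma quint_has_sum:
  assumes "Im T > 0"
  shows "((\<lambda>n. chi12 n * theta_term T 3 x n) has_sum quint T x) UNIV"
  unfolding quint_def using assms
  by (intro has_sum_infsum theta_term_summable[where B = 1] norm_chi12_le) auto

lemma theta_space_quint:
  assumes "Im T > 0"
  shows "theta_space T 3 (-1) 1 (quint T)"
proof (rule theta_spaceI[where h = chi12])
  show "chi12 (n + 2 * int 3) = - 1 * chi12 n" for n using chi12_add_6[of n] by simp
  show "chi12 n = 0" if "odd (n - 1)" for n using that by (intro chi12_even) auto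
qed (rule quint_has_sum[OF assms])

lemma quint_uminus:
  assumes "Im T > 0"
  shows "quint T (- x) = quint T x"
proof -
  have "((\<lambda>n. chi12 n * theta_term T 3 x n) has_sum quint T x) UNIV \<longleftrightarrow>
        ((\<lambda>n. chi12 n * theta_term T 3 (- x) n) has_sum quint T x) UNIV"
    by (rule has_sum_reindex_bij_witness[where i = uminus and j = uminus])
       (auto simp: theta_term_def chi12_uminus)
  thus ?thesis using quint_has_sum[OF assms, of x] quint_has_sum[OF assms, of "- x"]
    by (auto intro: has_sum_unique)
qed

text \<open>The triple product in base \<open>q ^ 3\<close> at \<open>w = q ^ 2\<close> has as its
  three factors the residue classes 0, 2, 1 modulo 3 of \<open>qpoch q q\<close>. The factor
  \<open>q^(1/24)\<close> of eta completes the exponent \<open>(3m\<^sup>2 + m)/2\<close> to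
  \<open>(6m+1)\<^sup>2/24\<close>.\<close>

lemma pentagonal_number_theorem:
  assumes "Im T > 0"
  shows "((\<lambda>m. (-1) powi m * theta_term T 3 0 (6 * m + 1)) has_sum dedekind_eta T) UNIV"
proof -
  define q where "q = exp (2 * of_real pi * \<i> * T)"
  have q: "norm q < 1" "q \<noteq> 0" using assms by (auto simp: q_def)
  have e: "exp (2 * of_real pi * \<i> * (3 * T)) = q ^ 3" "exp (2 * \<i> * (2 * of_real pi * T)) = q ^ 2"
    unfolding q_def exp_of_nat_mult[symmetric] by (simp_all add: mult_ac)
  have "(jterm (3 * T) (2 * of_real pi * T) has_sum qpoch (q ^ 3) (q ^ 3) * qpoch (q ^ 2) (q ^ 3) * qpoch (q ^ 3 / q ^ 2) (q ^ 3)) UNIV"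
    using jacobi_triple_product[of "3 * T" "2 * of_real pi * T"] assms unfolding e by simp
  also have "qpoch (q ^ 3) (q ^ 3) * qpoch (q ^ 2) (q ^ 3) * qpoch (q ^ 3 / q ^ 2) (q ^ 3) = qpoch q q"
    using qpoch_dissection[of q 3 q] q by (simp add: numeral_3_eq_3 numeral_2_eq_2 mult_ac)
  finally have "((\<lambda>m. exp (of_real pi * \<i> * T / 12) * jterm (3 * T) (2 * of_real pi * T) m) has_sum exp (of_real pi * \<i> * T / 12) * qpoch q q) UNIV"
    by (rule has_sum_cmult_right)
  moreover have "exp (of_real pi * \<i> * T / 12) * jterm (3 * T) (2 * of_real pi * T) m =
      (-1) powi m * theta_term T 3 0 (6 * m + 1)" for m
  proof -
    have "theta_term T 3 0 (6 * m + 1) = exp (of_real pi * \<i> * T / 12) *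
       exp (of_real pi * \<i> * (3 * T) * of_int (m * (m - 1)) + 2 * \<i> * of_int m * (2 * of_real pi * T))"
      unfolding exp_add[symmetric] theta_term_def
      by (intro arg_cong[where f = exp]) (simp add: field_simps power2_eq_square)
    thus ?thesis by (simp add: jterm_def)
  qed
  ultimately show ?thesis by (simp add: dedekind_eta_qpoch q_def)
qed

lemma has_sum_units_mod_6:
  fixes F :: "int \<Rightarrow> complex"
  assumes "\<And>n. n mod 6 \<noteq> 1 \<Longrightarrow> n mod 6 \<noteq> 5 \<Longrightarrow> F n = 0"
    and "((\<lambda>m. F (6 * m + 1)) has_sum A) UNIV" "((\<lambda>m. F (- (6 * m + 1))) has_sum B) UNIV"
  shows "(F has_sum A + B) UNIV"
proof -
  have iff: "n mod 6 = 5 \<longleftrightarrow> (- n) mod 6 = 1" for n :: int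
    by (simp add: zmod_zminus1_eq_if)
  have m1: "(6 * m + 1) mod 6 = 1" for m :: int
    using mod_mult_self2[of 1 6 m] by (simp add: add.commute)
  have d: "6 * (n div 6) + 1 = n" if "n mod 6 = 1" for n :: int
    using mult_div_mod_eq[of 6 n] that by simp
  have "((\<lambda>m. F (6 * m + 1)) has_sum A) UNIV \<longleftrightarrow> (F has_sum A) {n. n mod 6 = 1}"
    by (rule has_sum_reindex_bij_witness[where i = "\<lambda>n. n div 6" and j = "\<lambda>m. 6 * m + 1"])
       (simp_all add: m1 d)
  hence A: "(F has_sum A) {n. n mod 6 = 1}" using assms by simp
  have "((\<lambda>m. F (- (6 * m + 1))) has_sum B) UNIV \<longleftrightarrow> (F has_sum B) {n. (- n) mod 6 = 1}"
  proof (rule has_sum_reindex_bij_witness[where i = "\<lambda>n. (- n) div 6" and j = "\<lambda>m. - (6 * m + 1)"])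
    show "- (6 * (- n div 6) + 1) = n" if "n \<in> {n. (- n) mod 6 = 1}" for n :: int
    proof -
      have "6 * (- n div 6) + 1 = - n" by (rule d) (use that in \<open>simp only: mem_Collect_eq\<close>)
      thus ?thesis by linarith
    qed
    show "- (6 * m + 1) \<in> {n. (- n) mod 6 = 1}" for m :: int using m1[of m] by (simp only: mem_Collect_eq minus_minus)
  qed simp_all
  hence B: "(F has_sum B) {n. (- n) mod 6 = 1}" using assms by simp
  have "(F has_sum A + B) ({n. n mod 6 = 1} \<union> {n. (- n) mod 6 = 1})"
    by (rule has_sum_Un_disjoint[OF A B]) (auto simp: iff[symmetric])
  also have "?this \<longleftrightarrow> (F has_sum A + B) UNIV"
    by (rule has_sum_cong_neutral) (use assms(1) in \<open>auto simp: iff[symmetric]\<close>)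
  finally show ?thesis .
qed

lemma quint_0:
  assumes "Im T > 0"
  shows "quint T 0 = 2 * dedekind_eta T"
proof -
  have u: "theta_term T 3 0 (- n) = theta_term T 3 0 n" for n by (simp add: theta_term_def)
  have "((\<lambda>n. chi12 n * theta_term T 3 0 n) has_sum dedekind_eta T + dedekind_eta T) UNIV"
    by (rule has_sum_units_mod_6; (unfold u chi12_uminus chi12_6_mult_add_1)?)
       (auto simp: chi12_def intro!: pentagonal_number_theorem assms)
  from has_sum_unique[OF this quint_has_sum[OF assms]] show ?thesis by simp
qed

text \<open>At \<open>pi / 3\<close> the exponential is constant on the frequencies
  \<open>6m + 1\<close> and on their negatives, equal to \<open>c\<close> and \<open>1 / c\<close>.
  The two pentagonal series therefore combine to eta times
  \<open>2 * cos (pi / 3) = 1\<close>.\<close>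

lemma quint_pi_3:
  assumes "Im T > 0"
  shows "quint T (of_real pi / 3) = dedekind_eta T"
proof -
  define c where "c = exp (\<i> * of_real pi / 3)"
  have c': "exp (- (\<i> * of_real pi / 3)) = 1 / c"
    unfolding c_def exp_minus inverse_eq_divide by (rule refl)
  have t: "theta_term T 3 (of_real pi / 3) (6 * m + 1) = theta_term T 3 0 (6 * m + 1) * c"
    and t': "theta_term T 3 (of_real pi / 3) (- (6 * m + 1)) = theta_term T 3 0 (6 * m + 1) * (1 / c)" for m
  proof -
    have "theta_term T 3 (of_real pi / 3) (6 * m + 1) = theta_term T 3 0 (6 * m + 1) * (c * exp (of_int (2 * m) * (of_real pi * \<i>)))"
      unfolding theta_term_def c_def exp_add[symmetric]
      by (intro arg_cong[where f = exp]) (simp add: field_simps)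
    thus "theta_term T 3 (of_real pi / 3) (6 * m + 1) = theta_term T 3 0 (6 * m + 1) * c"
      unfolding exp_int_pi_i by simp
    have "theta_term T 3 (of_real pi / 3) (- (6 * m + 1)) = theta_term T 3 0 (6 * m + 1) * (exp (- (\<i> * of_real pi / 3)) * exp (of_int (2 * (- m)) * (of_real pi * \<i>)))"
      unfolding theta_term_def exp_add[symmetric]
      by (intro arg_cong[where f = exp]) (simp add: field_simps power2_eq_square)
    thus "theta_term T 3 (of_real pi / 3) (- (6 * m + 1)) = theta_term T 3 0 (6 * m + 1) * (1 / c)"
      unfolding exp_int_pi_i c' by simp
  qed
  have "((\<lambda>n. chi12 n * theta_term T 3 (of_real pi / 3) n) has_sum dedekind_eta T * c + dedekind_eta T * (1 / c)) UNIV"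
    by (rule has_sum_units_mod_6; (unfold t t' chi12_uminus chi12_6_mult_add_1 mult.assoc[symmetric])?)
       (auto simp: chi12_def intro!: has_sum_cmult_left pentagonal_number_theorem assms simp del: times_divide_eq_right)
  from has_sum_unique[OF this quint_has_sum[OF assms]] 
  have "quint T (of_real pi / 3) = dedekind_eta T * (c + 1 / c)" by (simp add: distrib_left)
  also have "c + 1 / c = 2 * cos (of_real pi / 3)"
    unfolding cos_exp_eq using c' by (simp add: c_def)
  also have "cos (of_real pi / 3 :: complex) = of_real (cos (pi / 3))"
    by (simp add: cos_of_real [symmetric] del: cos_of_real)
  finally show ?thesis by (simp add: cos_60)
qed

section \<open>Small spaces of theta functions and the dissection modulo 5\<close>

text \<open>\<open>theta_space\<close> only provides some coefficients, so a symmetry of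
  \<open>f\<close> is imposed on them by averaging \<open>h n\<close> with
  \<open>e * h (- n)\<close>. Reflection inverts the multiplier, and \<open>s * s = 1\<close> makes
  the inverse equal to \<open>s\<close>.\<close>

lemma theta_space_symmetric_coeffs:
  assumes "theta_space T d s r f" "s * s = 1" "\<And>x. f (- x) = e * f x" "e * e = 1"
  obtains h where "\<And>n. h (n + 2 * int d) = s * h n" "\<And>n. odd (n - r) \<Longrightarrow> h n = 0"
    "\<And>x. ((\<lambda>n. h n * theta_term T d x n) has_sum f x) UNIV" "\<And>n. h (- n) = e * h n"
proof -
  obtain h where h: "\<And>n. h (n + 2 * int d) = s * h n" "\<And>n. odd (n - r) \<Longrightarrow> h n = 0"
    "\<And>x. ((\<lambda>n. h n * theta_term T d x n) has_sum f x) UNIV"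
    using theta_spaceE[OF assms(1)] by blast
  define g where "g = (\<lambda>n. (h n + e * h (- n)) / 2)"
  show ?thesis
  proof (rule that[of g])
    show "g (n + 2 * int d) = s * g n" for n
    proof -
      have "s * h (- n - 2 * int d) = h (- n)" using h(1)[of "- n - 2 * int d"] by simp
      hence "s * (s * h (- n - 2 * int d)) = s * h (- n)" by simp
      hence "h (- (n + 2 * int d)) = s * h (- n)"
        using assms(2) by (simp add: mult.assoc[symmetric])
      thus ?thesis unfolding g_def h(1) by (simp add: field_simps)
    qed
    show "g n = 0" if "odd (n - r)" for n
    proof -
      have "odd (- n - r)" using that by presburger
      thus ?thesis using that h(2) by (simp add: g_def)
    qed
    show "g (- n) = e * g n" for n
      using assms(4) by (simp add: g_def field_simps mult.assoc[symmetric])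
    show "((\<lambda>n. g n * theta_term T d x n) has_sum f x) UNIV" for x
    proof -
      have "((\<lambda>n. h (- n) * theta_term T d x n) has_sum f (- x)) UNIV \<longleftrightarrow>
            ((\<lambda>n. h n * theta_term T d (- x) n) has_sum f (- x)) UNIV"
        by (rule has_sum_reindex_bij_witness[where i = uminus and j = uminus])
           (auto simp: theta_term_def)
      hence "((\<lambda>n. h (- n) * theta_term T d x n) has_sum e * f x) UNIV"
        using h(3)[of "- x"] assms(3) by simp
      from has_sum_cmult_right[OF has_sum_add[OF h(3)[of x] has_sum_cmult_right[OF this, of e]], of "1 / 2"]
      have "((\<lambda>n. 1 / 2 * (h n * theta_term T d x n + e * (h (- n) * theta_term T d x n))) has_sum 1 / 2 * (f x + e * (e * f x))) UNIV" .
      also have "(\<lambda>n. 1 / 2 * (h n * theta_term T d x n + e * (h (- n) * theta_term T d x n))) = (\<lambda>n. g n * theta_term T d x n)"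
        by (simp add: g_def field_simps)
      also have "1 / 2 * (f x + e * (e * f x)) = f x"
        using assms(4) by (simp add: mult.assoc[symmetric])
      finally show ?thesis .
    qed
  qed
qed

lemma atLeastLessThan_int_numeral:
  "{0..<8::int} = {0, 1, 2, 3, 4, 5, 6, 7}" "{0..<10::int} = {0, 1, 2, 3, 4, 5, 6, 7, 8, 9}"
proof -
  have "{0..<8::int} = {0..7}" "{0..<10::int} = {0..9}" by auto
  thus "{0..<8::int} = {0, 1, 2, 3, 4, 5, 6, 7}" "{0..<10::int} = {0, 1, 2, 3, 4, 5, 6, 7, 8, 9}"
    by (simp_all add: set_upto[symmetric] upto.simps del: set_upto)
qed

text \<open>The coefficients are odd, 8-periodic and supported on even \<open>n\<close>. This kills
  those at 0 and 4 and ties 6 to 2, so \<open>h 2\<close> is the only freedom. The function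
  \<open>theta1 (2 * x) T\<close> has the same shape, because
  \<open>theta_term T 4 x (2 * n) = theta_term T 1 (2 * x) n\<close>.\<close>

lemma odd_theta_space_4:
  assumes "Im T > 0" "theta_space T 4 1 0 f" "\<And>x. f (- x) = - f x"
  obtains c where "\<And>x. f x = c * theta1 (2 * x) T"
proof -
  obtain h where h: "\<And>n. h (n + 2 * int 4) = 1 * h n" "\<And>n. odd (n - 0) \<Longrightarrow> h n = 0"
    "\<And>x. ((\<lambda>n. h n * theta_term T 4 x n) has_sum f x) UNIV" "\<And>n. h (- n) = (-1) * h n"
    using theta_space_symmetric_coeffs[OF assms(2), of "-1"] assms(3) by auto
  \<comment> \<open>As \<open>theta1_coeff 1 = - \<i>\<close>, this \<open>c\<close> matches the
    coefficients at frequency 2.\<close>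
  define c where "c = \<i> * h 2"
  define g where "g = (\<lambda>n. if even n then theta1_coeff (n div 2) else 0)"
  have "h n - c * g n = 0" for n
  proof (rule twisted_periodic_eq_0[where D = 8 and s = 1])
    fix n
    have "g (n + 8) = g n"
      using theta1_coeff_add_2[of "n div 2"] theta1_coeff_add_2[of "n div 2 + 2"]
      by (simp add: g_def add.commute)
    thus "h (n + 8) - c * g (n + 8) = 1 * (h n - c * g n)" using h(1)[of n] by simp
  next
    fix n :: int assume n: "n \<in> {0..<8}"
    have "h 0 = 0" using h(4)[of 0] by simp
    moreover have "h 4 = 0" using h(4)[of 4] h(1)[of "-4"] by simp
    moreover have "h 6 = - h 2" using h(4)[of 2] h(1)[of "-2"] by simp
    moreover have "theta1_coeff 1 = - \<i>" "theta1_coeff 3 = \<i>" by (simp_all add: theta1_coeff_def)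
    moreover have "\<i> * h 2 * \<i> = - h 2" by (simp add: complex_eq_iff)
    ultimately show "h n - c * g n = 0"
      using n h(2) unfolding atLeastLessThan_int_numeral
      by (auto simp: g_def c_def theta1_coeff_def[of 0] theta1_coeff_def[of 2])
  qed auto
  hence h_eq: "h n = c * g n" for n by (simp add: algebra_simps)
  show ?thesis
  proof (rule that[of c])
    fix x
    have "((\<lambda>n. c * (theta1_coeff n * theta_term T 1 (2 * x) n)) has_sum c * theta1 (2 * x) T) UNIV"
      by (intro has_sum_cmult_right theta1_has_sum assms)
    also have "?this \<longleftrightarrow> ((\<lambda>n. h n * theta_term T 4 x n) has_sum c * theta1 (2 * x) T) {n. even n}"
      by (rule has_sum_reindex_bij_witness[where i = "\<lambda>n. n div 2" and j = "\<lambda>n. 2 * n"])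
         (auto simp: h_eq g_def theta_term_def field_simps)
    also have "\<dots> \<longleftrightarrow> ((\<lambda>n. h n * theta_term T 4 x n) has_sum c * theta1 (2 * x) T) UNIV"
      by (rule has_sum_cong_neutral) (auto simp: h_eq g_def)
    finally show "f x = c * theta1 (2 * x) T" using h(3)[of x] by (rule has_sum_unique[rotated])
  qed
qed

text \<open>For \<open>j = 1\<close> and \<open>j = 3\<close> the signs make this sequence even and
  antiperiodic under \<open>n \<mapsto> n + 10\<close>, as the coefficients of an even function of
  degree 5 with multiplier -1 must be.\<close>

definition mod10_coeff :: "int \<Rightarrow> int \<Rightarrow> complex" where
  "mod10_coeff j n = (if n mod 10 = j then (-1) powi (n div 10) else if n mod 10 = 10 - j then (-1) powi (n div 10 + 1) else 0)"

definition theta_basis :: "complex \<Rightarrow> int \<Rightarrow> complex \<Rightarrow> complex" where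
  "theta_basis T j x = (\<Sum>\<^sub>\<infinity>n. mod10_coeff j n * theta_term T 5 x n)"

lemma theta_basis_has_sum:
  assumes "Im T > 0"
  shows "((\<lambda>n. mod10_coeff j n * theta_term T 5 x n) has_sum theta_basis T j x) UNIV"
  unfolding theta_basis_def using assms
  by (intro has_sum_infsum theta_term_summable[where B = 1]) (auto simp: mod10_coeff_def norm_power_int)

lemma even_theta_space_5:
  assumes "Im T > 0" "theta_space T 5 (-1) 1 f" "\<And>x. f (- x) = f x"
  obtains \<alpha> \<beta> where "\<And>x. f x = \<alpha> * theta_basis T 1 x + \<beta> * theta_basis T 3 x"
proof -
  have ev: "(-1 :: complex) * (-1) = 1" "\<And>x. f (- x) = 1 * f x" "(1 :: complex) * 1 = 1"
    by (simp_all only: assms(3)) auto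
  obtain h where h: "\<And>n. h (n + 2 * int 5) = (-1) * h n" "\<And>n. odd (n - 1) \<Longrightarrow> h n = 0"
    "\<And>x. ((\<lambda>n. h n * theta_term T 5 x n) has_sum f x) UNIV" "\<And>n. h (- n) = 1 * h n"
    using theta_space_symmetric_coeffs[OF assms(2) ev] by blast
  have eq0: "h n - (h 1 * mod10_coeff 1 n + h 3 * mod10_coeff 3 n) = 0" for n
  proof (rule twisted_periodic_eq_0[where D = 10 and s = "-1"])
    fix n
    have "mod10_coeff j (n + 10) = - mod10_coeff j n" for j
      by (simp add: mod10_coeff_def power_int_add)
    thus "h (n + 10) - (h 1 * mod10_coeff 1 (n + 10) + h 3 * mod10_coeff 3 (n + 10)) =
       -1 * (h n - (h 1 * mod10_coeff 1 n + h 3 * mod10_coeff 3 n))" using h(1)[of n] by simp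
  next
    fix n :: int assume n: "n \<in> {0..<10}"
    \<comment> \<open>Evenness gives \<open>h 5 = h (-5)\<close> and antiperiodicity
      \<open>h 5 = - h (-5)\<close>. The frequencies 7 and 9 reflect to 3 and 1, so only
      \<open>h 1\<close> and \<open>h 3\<close> remain free.\<close>
    have "h 5 = 0" using h(4)[of 5] h(1)[of "-5"] by simp
    moreover have "h 7 = - h 3" using h(4)[of 3] h(1)[of "-3"] by simp
    moreover have "h 9 = - h 1" using h(4)[of 1] h(1)[of "-1"] by simp
    moreover have "h 0 = 0" "h 2 = 0" "h 4 = 0" "h 6 = 0" "h 8 = 0"
      using h(2)[of 0] h(2)[of 2] h(2)[of 4] h(2)[of 6] h(2)[of 8] by simp_all
    ultimately show "h n - (h 1 * mod10_coeff 1 n + h 3 * mod10_coeff 3 n) = 0"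
      using n unfolding atLeastLessThan_int_numeral insert_iff empty_iff
      by (elim disjE) (simp_all add: mod10_coeff_def)
  qed auto
  have h_eq: "h n = h 1 * mod10_coeff 1 n + h 3 * mod10_coeff 3 n" for n
    using eq0[of n] by (simp only: right_minus_eq)
  show ?thesis
  proof (rule that[of "h 1" "h 3"])
    fix x
    have "((\<lambda>n. h 1 * (mod10_coeff 1 n * theta_term T 5 x n) + h 3 * (mod10_coeff 3 n * theta_term T 5 x n))
        has_sum h 1 * theta_basis T 1 x + h 3 * theta_basis T 3 x) UNIV"
      by (intro has_sum_add has_sum_cmult_right theta_basis_has_sum assms)
    also have "(\<lambda>n. h 1 * (mod10_coeff 1 n * theta_term T 5 x n) + h 3 * (mod10_coeff 3 n * theta_term T 5 x n)) =
       (\<lambda>n. h n * theta_term T 5 x n)"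
    proof
      fix n
      show "h 1 * (mod10_coeff 1 n * theta_term T 5 x n) + h 3 * (mod10_coeff 3 n * theta_term T 5 x n) =
          h n * theta_term T 5 x n"
        unfolding h_eq[of n] by (simp add: algebra_simps)
    qed
    finally show "f x = h 1 * theta_basis T 1 x + h 3 * theta_basis T 3 x"
      using h(3)[of x] by (rule has_sum_unique[rotated])
  qed
qed

text \<open>\<open>D x y\<close> is the determinant of the vectors \<open>(p x, r x)\<close> and
  \<open>(p y, r y)\<close>. If it is nonzero at some pair, Cramer's rule expresses \<open>R\<close>
  through its value there. If it vanishes identically, all these vectors are parallel, and
  \<open>R x x = 0\<close> forces \<open>R\<close> to vanish, so \<open>K = 0\<close> works.\<close>

lemma alternating_on_plane:
  fixes R :: "'a \<Rightarrow> 'a \<Rightarrow> complex" and p r :: "'a \<Rightarrow> complex"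
  assumes span: "\<And>y. \<exists>\<alpha> \<beta>. \<forall>x. R x y = \<alpha> * p x + \<beta> * r x"
    and alt: "\<And>x y. R x y = - R y x"
  obtains K where "\<And>x y. R x y = K * (p x * r y - p y * r x)"
proof -
  define D where "D = (\<lambda>x y. p x * r y - p y * r x)"
  have diag: "R x x = 0" for x using alt[of x x] by simp
  show ?thesis
  proof (cases "\<exists>u v. D u v \<noteq> 0")
    case True
    then obtain u v where uv: "D u v \<noteq> 0" by blast
    \<comment> \<open>Cramer's rule: the vector at \<open>x\<close> times \<open>D u v\<close> is
      \<open>D x v\<close> times the vector at \<open>u\<close> plus \<open>D u x\<close> times the
      vector at \<open>v\<close>.\<close>
    have expand: "R x y * D u v = R u y * D x v + R v y * D u x" for x y
    proof -
      obtain \<alpha> \<beta> where "\<forall>x. R x y = \<alpha> * p x + \<beta> * r x" using span by blast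
      thus ?thesis by (simp add: D_def algebra_simps)
    qed
    have 1: "R u y * D u v = R u v * D u y" for y
      using expand[of y u] alt[of y u] alt[of v u] by (simp add: diag)
    have 2: "R v y * D u v = - R u v * D y v" for y
    proof -
      have "- (R v y * D u v) = R u v * D y v" using expand[of y v] alt[of y v] by (simp add: diag)
      thus ?thesis by (metis minus_minus mult_minus_left)
    qed
    have "R x y = R u v / D u v * D x y" for x y
    proof -
      have "R x y * D u v * D u v = R u y * D u v * D x v + R v y * D u v * D u x"
        unfolding expand[of x y] by (simp add: algebra_simps)
      also have "\<dots> = R u v * (D u y * D x v - D y v * D u x)"
        unfolding 1[of y] 2[of y] by (simp add: algebra_simps)
      \<comment> \<open>The Pluecker relation for four vectors in a plane.\<close>
      also have "D u y * D x v - D y v * D u x = D u v * D x y"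
        by (simp add: D_def algebra_simps)
      finally show ?thesis using uv by (simp add: field_simps)
    qed
    thus ?thesis using that unfolding D_def by blast
  next
    case False
    hence D0: "p x * r y = p y * r x" for x y unfolding D_def by simp
    have "R x y = 0" for x y
    proof -
      obtain \<alpha> \<beta> where R: "\<And>x. R x y = \<alpha> * p x + \<beta> * r x" using span by blast
      obtain \<gamma> \<delta> where R': "\<And>z. R z x = \<gamma> * p z + \<delta> * r z" using span by blast
      have y: "\<alpha> * p y + \<beta> * r y = 0" using R[of y] diag by simp
      have "p y * R x y = p x * (\<alpha> * p y + \<beta> * r y)" "r y * R x y = r x * (\<alpha> * p y + \<beta> * r y)"
        unfolding R using D0[of x y] by (simp_all add: algebra_simps)
      hence "p y * R x y = 0" "r y * R x y = 0" unfolding y by simp_all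
      \<comment> \<open>If the vector at \<open>y\<close> is zero, \<open>R y x\<close> is expanded
        in its first argument instead and alternation transfers the result.\<close>
      moreover have "R x y = 0" if "p y = 0" "r y = 0" using R'[of y] that alt[of x y] by simp
      ultimately show ?thesis by auto
    qed
    thus ?thesis using that[of 0] by simp
  qed
qed

section \<open>Splitting the pentagonal series modulo 5\<close>

lemma has_sum_mod_5:
  fixes F :: "int \<Rightarrow> complex"
  assumes "(F has_sum S) UNIV" "\<And>j. j \<in> {0, 1, 2, 3, 4} \<Longrightarrow> ((\<lambda>m. F (5 * m + j)) has_sum A j) UNIV"
  shows "S = A 0 + A 1 + A 2 + A 3 + A 4"
proof -
  have "(F has_sum S) UNIV \<longleftrightarrow> ((\<lambda>(j, m). F (5 * m + j)) has_sum S) ({0, 1, 2, 3, 4} \<times> UNIV)"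
  proof (rule has_sum_reindex_bij_witness[where i = "\<lambda>(j, m). 5 * m + j" and j = "\<lambda>n. (n mod 5, n div 5)"])
    fix n :: int
    have "n mod 5 \<in> {0..<5}" by simp
    also have "{0..<5::int} = {0, 1, 2, 3, 4}" by auto
    finally show "(n mod 5, n div 5) \<in> {0, 1, 2, 3, 4} \<times> UNIV" by simp
  qed auto
  with assms(1) have "((\<lambda>(j, m). F (5 * m + j)) has_sum S) ({0, 1, 2, 3, 4} \<times> UNIV)" by simp
  hence "(A has_sum S) {0, 1, 2, 3, 4}"
    by (rule has_sum_SigmaD) (use assms(2) in auto)
  moreover have "(A has_sum (A 0 + A 1 + A 2 + A 3 + A 4)) {0, 1, 2, 3, 4}"
    by (rule has_sum_finiteI) auto
  ultimately show ?thesis by (rule has_sum_unique)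
qed

text \<open>The series \<open>quint (\<tau> / 5) 0\<close>, which is twice the left-hand side, is
  summed over residue classes modulo 5. Class 0 reproduces \<open>- quint (5 * \<tau>) 0\<close>,
  and \<open>n \<mapsto> - n\<close> pairs class 1 with 4 and 2 with 3, so that a common factor 2
  cancels.\<close>

lemma dedekind_eta_dissection:
  assumes "Im \<tau> > 0"
  shows "dedekind_eta (\<tau> / 5) = exp (3 * of_real pi * \<i> * \<tau> / 5) * quint (5 * \<tau>) (of_real pi * \<tau>)
      - dedekind_eta (5 * \<tau>) - exp (12 * of_real pi * \<i> * \<tau> / 5) * quint (5 * \<tau>) (2 * of_real pi * \<tau>)"
proof -
  have im: "Im (\<tau> / 5) > 0" "Im (5 * \<tau>) > 0" using assms by auto
  define F where "F = (\<lambda>n. chi12 n * theta_term (\<tau> / 5) 3 0 n)"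
  define a where "a = exp (3 * of_real pi * \<i> * \<tau> / 5)"
  define b where "b = exp (12 * of_real pi * \<i> * \<tau> / 5)"
  have F_uminus: "F (- n) = F n" for n by (simp add: F_def theta_term_def chi12_uminus)
  have F0: "F (5 * m) = - 1 * (chi12 m * theta_term (5 * \<tau>) 3 0 m)" for m
  proof -
    have "theta_term (\<tau> / 5) 3 0 (5 * m) = theta_term (5 * \<tau>) 3 0 m"
      by (simp add: theta_term_def power_mult_distrib mult_ac)
    thus ?thesis by (simp add: F_def chi12_mult_5)
  qed
  \<comment> \<open>Classes 1 and 2 are represented by 6 and 12, since adding 6 only flips the sign
    of \<open>chi12\<close> and adding 12 preserves it. Expanding the squares then produces the
    arguments \<open>pi * \<tau>\<close> and \<open>2 * pi * \<tau>\<close>.\<close>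
  have F1: "F (5 * m + 6) = a * (chi12 m * theta_term (5 * \<tau>) 3 (of_real pi * \<tau>) m)" for m
  proof -
    have "theta_term (\<tau> / 5) 3 0 (5 * m + 6) = a * theta_term (5 * \<tau>) 3 (of_real pi * \<tau>) m"
      unfolding theta_term_def a_def exp_add[symmetric]
      by (intro arg_cong[where f = exp]) (simp add: field_simps power2_eq_square)
    thus ?thesis by (simp add: F_def chi12_mult_5 chi12_add_6)
  qed
  have F2: "F (5 * m + 12) = - b * (chi12 m * theta_term (5 * \<tau>) 3 (2 * of_real pi * \<tau>) m)" for m
  proof -
    have "theta_term (\<tau> / 5) 3 0 (5 * m + 12) = b * theta_term (5 * \<tau>) 3 (2 * of_real pi * \<tau>) m"
      unfolding theta_term_def b_def exp_add[symmetric]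
      by (intro arg_cong[where f = exp]) (simp add: field_simps power2_eq_square)
    thus ?thesis using chi12_add_12_mult[of "5 * m" 1] by (simp add: F_def chi12_mult_5)
  qed
  define A1 where "A1 = a * quint (5 * \<tau>) (of_real pi * \<tau>)"
  define A2 where "A2 = - b * quint (5 * \<tau>) (2 * of_real pi * \<tau>)"
  have S0: "((\<lambda>m. F (5 * m)) has_sum - 1 * quint (5 * \<tau>) 0) UNIV"
    unfolding F0 by (intro has_sum_cmult_right quint_has_sum im)
  have S1: "((\<lambda>m. F (5 * m + 6)) has_sum A1) UNIV"
    unfolding F1 A1_def by (intro has_sum_cmult_right quint_has_sum im)
  have S2: "((\<lambda>m. F (5 * m + 12)) has_sum A2) UNIV"
    unfolding F2 A2_def by (intro has_sum_cmult_right quint_has_sum im)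
  have r1: "((\<lambda>m. F (5 * m + 1)) has_sum A1) UNIV"
  proof -
    have "((\<lambda>m. F (5 * m + 6)) has_sum A1) UNIV \<longleftrightarrow> ((\<lambda>m. F (5 * m + 1)) has_sum A1) UNIV"
      by (rule has_sum_reindex_bij_witness[where i = "\<lambda>m. m - 1" and j = "\<lambda>m. m + 1"]) (auto simp: algebra_simps)
    thus ?thesis using S1 by simp
  qed
  have r2: "((\<lambda>m. F (5 * m + 2)) has_sum A2) UNIV"
  proof -
    have "((\<lambda>m. F (5 * m + 12)) has_sum A2) UNIV \<longleftrightarrow> ((\<lambda>m. F (5 * m + 2)) has_sum A2) UNIV"
      by (rule has_sum_reindex_bij_witness[where i = "\<lambda>m. m - 2" and j = "\<lambda>m. m + 2"]) (auto simp: algebra_simps)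
    thus ?thesis using S2 by simp
  qed
  have r3: "((\<lambda>m. F (5 * m + 3)) has_sum A2) UNIV"
  proof -
    have "((\<lambda>m. F (5 * m + 12)) has_sum A2) UNIV \<longleftrightarrow> ((\<lambda>m. F (5 * m + 3)) has_sum A2) UNIV"
    proof (rule has_sum_reindex_bij_witness[where i = "\<lambda>m. - m - 3" and j = "\<lambda>m. - m - 3"])
      show "F (5 * (- m - 3) + 3) = F (5 * m + 12)" for m
        using F_uminus[of "5 * m + 12"] by (simp add: algebra_simps)
    qed auto
    thus ?thesis using S2 by simp
  qed
  have r4: "((\<lambda>m. F (5 * m + 4)) has_sum A1) UNIV"
  proof -
    have "((\<lambda>m. F (5 * m + 6)) has_sum A1) UNIV \<longleftrightarrow> ((\<lambda>m. F (5 * m + 4)) has_sum A1) UNIV"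
    proof (rule has_sum_reindex_bij_witness[where i = "\<lambda>m. - m - 2" and j = "\<lambda>m. - m - 2"])
      show "F (5 * (- m - 2) + 4) = F (5 * m + 6)" for m
        using F_uminus[of "5 * m + 6"] by (simp add: algebra_simps)
    qed auto
    thus ?thesis using S1 by simp
  qed
  define A :: "int \<Rightarrow> complex" where
    "A = (\<lambda>j. if j = 0 then - 1 * quint (5 * \<tau>) 0 else if j = 1 \<or> j = 4 then A1 else A2)"
  have "quint (\<tau> / 5) 0 = A 0 + A 1 + A 2 + A 3 + A 4"
  proof (rule has_sum_mod_5)
    show "(F has_sum quint (\<tau> / 5) 0) UNIV"
      unfolding F_def by (rule quint_has_sum[OF im(1)])
    show "((\<lambda>m. F (5 * m + j)) has_sum A j) UNIV" if "j \<in> {0, 1, 2, 3, 4}" for j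
      using that S0 r1 r2 r3 r4 by (auto simp: A_def)
  qed
  hence "2 * dedekind_eta (\<tau> / 5) = - 2 * dedekind_eta (5 * \<tau>) + 2 * A1 + 2 * A2"
    unfolding quint_0[OF im(1)] A_def quint_0[OF im(2)] by simp
  hence "2 * dedekind_eta (\<tau> / 5) = 2 * (A1 - dedekind_eta (5 * \<tau>) + A2)" by (simp add: algebra_simps)
  hence "dedekind_eta (\<tau> / 5) = A1 - dedekind_eta (5 * \<tau>) + A2"
    by (simp only: mult_cancel_left) simp
  thus ?thesis by (simp add: A1_def A2_def a_def b_def)
qed

section \<open>The quintuple product and fifth roots of unity\<close>

text \<open>In this strip \<open>norm q < norm w \<le> 1\<close>, so in the product every factor
  except \<open>1 - 1 / w\<close> is 1 minus a number of norm below 1.\<close>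

lemma theta1_nonzero:
  assumes "Im T > 0" "Im z \<ge> 0" "Im z < pi * Im T" "exp (2 * \<i> * z) \<noteq> 1"
  shows "theta1 z T \<noteq> 0"
proof -
  define q where "q = exp (2 * of_real pi * \<i> * T)"
  define w where "w = exp (2 * \<i> * z)"
  have q: "norm q < 1" using assms by (simp add: q_def)
  have w: "norm w \<le> 1" "norm q < norm w" using assms by (simp_all add: q_def w_def)
  have w0: "norm w > 0" by (simp add: w_def)
  have "norm (w * q) < 1"
    using mult_mono[of "norm w" 1 "norm q" "norm q"] w q by (simp add: norm_mult)
  hence 1: "w * q * q ^ n \<noteq> 1" for n using q by (intro mult_power_neq_1)
  have 2: "1 / w * q ^ n \<noteq> 1" for n
  proof (cases n)
    case 0
    thus ?thesis using assms(4) by (simp add: w_def)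
  next
    case (Suc m)
    have "norm (q / w) < 1" using w w0 by (simp add: norm_divide)
    hence "q / w * q ^ m \<noteq> 1" by (intro mult_power_neq_1 q)
    thus ?thesis using Suc by (simp add: field_simps)
  qed
  have "qpoch q q \<noteq> 0" by (rule qpoch_nonzero[OF q mult_power_neq_1[OF q q]])
  moreover have "qpoch (w * q) q \<noteq> 0" by (rule qpoch_nonzero[OF q 1])
  moreover have "qpoch (1 / w) q \<noteq> 0" by (rule qpoch_nonzero[OF q 2])
  ultimately show ?thesis unfolding theta1_product[OF assms(1)] q_def w_def by simp
qed

text \<open>The left-hand side is odd of degree \<open>1 + 3 = 4\<close> with even frequencies, so
  it is a multiple of \<open>theta1 (2 * x) T\<close>. The constant is read off at
  \<open>x = pi / 3\<close>, where \<open>2 * x = pi - x\<close> makes the two theta values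
  equal.\<close>

lemma quintuple_product_identity:
  assumes "Im T > 0"
  shows "theta1 x T * quint T x = dedekind_eta T * theta1 (2 * x) T"
proof -
  have "theta_space T (1 + 3) (-1 * -1) (1 + 1) (\<lambda>x. theta1 x T * quint T x)"
    by (intro theta_space_mult theta_space_theta1 theta_space_quint assms) auto
  hence "theta_space T 4 1 2 (\<lambda>x. theta1 x T * quint T x)" by simp
  hence "theta_space T 4 1 0 (\<lambda>x. theta1 x T * quint T x)" by (rule theta_space_parity) simp
  moreover have "theta1 (- x) T * quint T (- x) = - (theta1 x T * quint T x)" for x
    unfolding theta1_minus[OF assms] quint_uminus[OF assms] by simp
  ultimately obtain c where c: "\<And>x. theta1 x T * quint T x = c * theta1 (2 * x) T"
    using odd_theta_space_4[OF assms] by blast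
  let ?z = "of_real pi / 3 :: complex"
  have "theta1 (2 * ?z) T = theta1 (- ?z + of_real pi) T" by (simp add: field_simps)
  also have "\<dots> = theta1 ?z T" unfolding theta1_add_pi[OF assms] theta1_minus[OF assms] by simp
  finally have "theta1 (2 * ?z) T = theta1 ?z T" .
  moreover have "theta1 ?z T \<noteq> 0"
  proof (rule theta1_nonzero[OF assms])
    show "exp (2 * \<i> * ?z) \<noteq> 1"
    proof
      assume "exp (2 * \<i> * ?z) = 1"
      hence "sin (2 * ?z) = 0"
        unfolding sin_exp_eq by (simp add: exp_minus mult_ac)
      moreover have "2 * ?z = of_real (2 * pi / 3)" by simp
      ultimately have "sin (2 * pi / 3) = 0" by (metis sin_of_real of_real_eq_0_iff)
      thus False using sin_gt_zero[of "2 * pi / 3"] by simp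
    qed
  qed (use assms in auto)
  ultimately have "c = dedekind_eta T" using c[of ?z] quint_pi_3[OF assms] by simp
  thus ?thesis using c by simp
qed

definition inverse_rogers_ramanujan :: "complex \<Rightarrow> complex" where
  "inverse_rogers_ramanujan \<tau> = exp (3 * of_real pi * \<i> * \<tau> / 5) *
     theta1 (2 * of_real pi * \<tau>) (5 * \<tau>) / theta1 (of_real pi * \<tau>) (5 * \<tau>)"

lemma theta1_pi_tau_nonzero:
  assumes "Im \<tau> > 0"
  shows "theta1 (of_real pi * \<tau>) (5 * \<tau>) \<noteq> 0" "theta1 (2 * of_real pi * \<tau>) (5 * \<tau>) \<noteq> 0"
proof -
  have "norm (exp (2 * \<i> * z)) \<noteq> 1" if "Im z > 0" for z using that by simp
  hence *: "exp (2 * \<i> * z) \<noteq> 1" if "Im z > 0" for z using that by (metis norm_one)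
  have pos: "pi * Im \<tau> > 0" using assms by simp
  show "theta1 (of_real pi * \<tau>) (5 * \<tau>) \<noteq> 0" "theta1 (2 * of_real pi * \<tau>) (5 * \<tau>) \<noteq> 0"
    by (rule theta1_nonzero[OF _ _ _ *]; use assms pos in simp)+
qed

lemma theta1_4_pi_tau:
  assumes "Im \<tau> > 0"
  shows "theta1 (4 * of_real pi * \<tau>) (5 * \<tau>) = exp (- 3 * of_real pi * \<i> * \<tau>) * theta1 (of_real pi * \<tau>) (5 * \<tau>)"
proof -
  have im: "Im (5 * \<tau>) > 0" using assms by simp
  have "4 * of_real pi * \<tau> = - (of_real pi * \<tau>) + of_real pi * (5 * \<tau>)" by (simp add: algebra_simps)
  hence "theta1 (4 * of_real pi * \<tau>) (5 * \<tau>) = exp (- of_real pi * \<i> * (5 * \<tau>) - 2 * \<i> * - (of_real pi * \<tau>)) * theta1 (of_real pi * \<tau>) (5 * \<tau>)"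
    by (simp only: theta1_quasi_period[OF im] theta1_minus[OF im]) simp
  also have "- of_real pi * \<i> * (5 * \<tau>) - 2 * \<i> * - (of_real pi * \<tau>) = - 3 * of_real pi * \<i> * \<tau>"
    by (simp add: algebra_simps)
  finally show ?thesis .
qed

lemma theta1_3_pi_tau:
  assumes "Im \<tau> > 0"
  shows "theta1 (3 * of_real pi * \<tau>) (5 * \<tau>) = exp (- of_real pi * \<i> * \<tau>) * theta1 (2 * of_real pi * \<tau>) (5 * \<tau>)"
proof -
  have im: "Im (5 * \<tau>) > 0" using assms by simp
  have "3 * of_real pi * \<tau> = - (2 * of_real pi * \<tau>) + of_real pi * (5 * \<tau>)" by (simp add: algebra_simps)
  hence "theta1 (3 * of_real pi * \<tau>) (5 * \<tau>) = exp (- of_real pi * \<i> * (5 * \<tau>) - 2 * \<i> * - (2 * of_real pi * \<tau>)) * theta1 (2 * of_real pi * \<tau>) (5 * \<tau>)"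
    by (simp only: theta1_quasi_period[OF im] theta1_minus[OF im]) simp
  also have "- of_real pi * \<i> * (5 * \<tau>) - 2 * \<i> * - (2 * of_real pi * \<tau>) = - of_real pi * \<i> * \<tau>"
    by (simp add: algebra_simps)
  finally show ?thesis .
qed

lemma quint_pi_tau:
  assumes "Im \<tau> > 0"
  defines "a \<equiv> theta1 (of_real pi * \<tau>) (5 * \<tau>)" and "b \<equiv> theta1 (2 * of_real pi * \<tau>) (5 * \<tau>)"
  shows "quint (5 * \<tau>) (of_real pi * \<tau>) = dedekind_eta (5 * \<tau>) * b / a"
    and "quint (5 * \<tau>) (2 * of_real pi * \<tau>) = dedekind_eta (5 * \<tau>) * exp (- 3 * of_real pi * \<i> * \<tau>) * a / b"
proof -
  have im: "Im (5 * \<tau>) > 0" using assms by simp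
  have e: "2 * (of_real pi * \<tau>) = 2 * of_real pi * \<tau>" "2 * (2 * of_real pi * \<tau>) = 4 * of_real pi * \<tau>" by simp_all
  have "a * quint (5 * \<tau>) (of_real pi * \<tau>) = dedekind_eta (5 * \<tau>) * b"
    using quintuple_product_identity[OF im, of "of_real pi * \<tau>"] unfolding a_def b_def e .
  thus "quint (5 * \<tau>) (of_real pi * \<tau>) = dedekind_eta (5 * \<tau>) * b / a"
    using theta1_pi_tau_nonzero[OF assms(1)] by (simp add: a_def field_simps)
  have "b * quint (5 * \<tau>) (2 * of_real pi * \<tau>) = dedekind_eta (5 * \<tau>) * (exp (- 3 * of_real pi * \<i> * \<tau>) * a)"
    using quintuple_product_identity[OF im, of "2 * of_real pi * \<tau>"]
    unfolding a_def b_def e theta1_4_pi_tau[OF assms(1)] .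
  thus "quint (5 * \<tau>) (2 * of_real pi * \<tau>) = dedekind_eta (5 * \<tau>) * exp (- 3 * of_real pi * \<i> * \<tau>) * a / b"
    using theta1_pi_tau_nonzero[OF assms(1)] by (simp add: b_def field_simps)
qed

lemma dedekind_eta_fifth:
  assumes "Im \<tau> > 0"
  defines "v \<equiv> inverse_rogers_ramanujan \<tau>"
  shows "dedekind_eta (\<tau> / 5) = dedekind_eta (5 * \<tau>) * (v - 1 - 1 / v)"
proof -
  define a where "a = theta1 (of_real pi * \<tau>) (5 * \<tau>)"
  define b where "b = theta1 (2 * of_real pi * \<tau>) (5 * \<tau>)"
  have "exp (12 * of_real pi * \<i> * \<tau> / 5) * exp (- 3 * of_real pi * \<i> * \<tau>) = exp (- (3 * of_real pi * \<i> * \<tau> / 5))"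
    unfolding exp_add[symmetric] by (intro arg_cong[where f = exp]) (simp add: field_simps)
  hence e: "exp (12 * of_real pi * \<i> * \<tau> / 5) * exp (- 3 * of_real pi * \<i> * \<tau>) = 1 / exp (3 * of_real pi * \<i> * \<tau> / 5)"
    unfolding exp_minus inverse_eq_divide .
  have "exp (12 * of_real pi * \<i> * \<tau> / 5) * (dedekind_eta (5 * \<tau>) * exp (- 3 * of_real pi * \<i> * \<tau>) * a / b) =
     dedekind_eta (5 * \<tau>) * (exp (12 * of_real pi * \<i> * \<tau> / 5) * exp (- 3 * of_real pi * \<i> * \<tau>)) * a / b"
    by (simp only: mult_ac times_divide_eq_right)
  also have "\<dots> = dedekind_eta (5 * \<tau>) * (1 / v)"
    unfolding e by (simp add: v_def inverse_rogers_ramanujan_def a_def b_def)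
  finally have *: "exp (12 * of_real pi * \<i> * \<tau> / 5) * (dedekind_eta (5 * \<tau>) * exp (- 3 * of_real pi * \<i> * \<tau>) * a / b) =
      dedekind_eta (5 * \<tau>) * (1 / v)" .
  show ?thesis
    unfolding dedekind_eta_dissection[OF assms(1)] quint_pi_tau[OF assms(1)] a_def[symmetric] b_def[symmetric] *
    by (simp add: v_def inverse_rogers_ramanujan_def a_def b_def algebra_simps)
qed

section \<open>Products over the fifth roots of unity\<close>

lemma prod_fifth_roots:
  fixes \<omega> x c :: complex
  assumes "\<omega> ^ 5 = 1" "\<omega> \<noteq> 1"
  shows "(\<Prod>k<5. \<omega> ^ k * x - c) = x ^ 5 - c ^ 5"
proof -
  have "(\<omega> - 1) * (1 + \<omega> + \<omega> ^ 2 + \<omega> ^ 3 + \<omega> ^ 4) = \<omega> ^ 5 - 1"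
    by (simp add: algebra_simps eval_nat_numeral)
  hence s: "1 + \<omega> + \<omega> ^ 2 + \<omega> ^ 3 + \<omega> ^ 4 = 0" using assms by simp
  have "(\<Prod>k<5. \<omega> ^ k * x - c) = (x - c) * (\<omega> * x - c) * (\<omega> ^ 2 * x - c) * (\<omega> ^ 3 * x - c) * (\<omega> ^ 4 * x - c)"
    by (simp add: eval_nat_numeral)
  also have "\<dots> = x ^ 5 - c ^ 5" using s by algebra
  finally show ?thesis .
qed

lemma prod_qpoch_fifth_roots:
  fixes \<omega> x q :: complex
  assumes "\<omega> ^ 5 = 1" "\<omega> \<noteq> 1" "norm q < 1"
  shows "(\<Prod>k<5. qpoch (\<omega> ^ k * x) q) = qpoch (x ^ 5) (q ^ 5)"
proof -
  have q5: "norm (q ^ 5) < 1" using assms(3) by (simp add: norm_power power_less_one_iff)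
  have "(\<lambda>N. \<Prod>k<5. \<Prod>n<N. 1 - \<omega> ^ k * x * q ^ n) \<longlonglongrightarrow> (\<Prod>k<5. qpoch (\<omega> ^ k * x) q)"
    by (intro tendsto_prod qpoch_LIMSEQ assms)
  also have "(\<lambda>N. \<Prod>k<5. \<Prod>n<N. 1 - \<omega> ^ k * x * q ^ n) = (\<lambda>N. \<Prod>n<N. 1 - x ^ 5 * (q ^ 5) ^ n)"
  proof
    fix N
    have "(\<Prod>k<5. \<Prod>n<N. 1 - \<omega> ^ k * x * q ^ n) = (\<Prod>n<N. \<Prod>k<5. 1 - \<omega> ^ k * x * q ^ n)"
      by (rule prod.swap)
    also have "\<dots> = (\<Prod>n<N. 1 - x ^ 5 * (q ^ 5) ^ n)"
    proof (rule prod.cong[OF refl])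
      fix n
      have "(\<Prod>k<5. 1 - \<omega> ^ k * x * q ^ n) = (\<Prod>k<5. (-1) * (\<omega> ^ k * (x * q ^ n) - 1))"
        by (intro prod.cong) auto
      also have "\<dots> = (\<Prod>k<(5::nat). -1) * (\<Prod>k<5. \<omega> ^ k * (x * q ^ n) - 1)"
        by (rule prod.distrib)
      also have "\<dots> = 1 - (x * q ^ n) ^ 5"
        unfolding prod_fifth_roots[OF assms(1,2)] by simp
      also have "(x * q ^ n) ^ 5 = x ^ 5 * (q ^ 5) ^ n"
        by (simp add: power_mult_distrib power_mult[symmetric] mult.commute)
      finally show "(\<Prod>k<5. 1 - \<omega> ^ k * x * q ^ n) = 1 - x ^ 5 * (q ^ 5) ^ n" .
    qed
    finally show "(\<Prod>k<5. \<Prod>n<N. 1 - \<omega> ^ k * x * q ^ n) = (\<Prod>n<N. 1 - x ^ 5 * (q ^ 5) ^ n)" .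
  qed
  finally show ?thesis using qpoch_LIMSEQ[OF q5] by (rule LIMSEQ_unique)
qed

text \<open>Each twisted product is dissected modulo 5 into products in the common base
  \<open>q = t ^ 5\<close>. For exponents 1 to 4 of \<open>t\<close> the product over
  \<open>k\<close> runs through all fifth roots of unity and yields a residue class of
  \<open>qpoch q q\<close> modulo 5. Exponent 5 is insensitive to \<open>k\<close> and yields
  \<open>qpoch q q ^ 5\<close>. The extra \<open>qpoch (q ^ 5) (q ^ 5)\<close> is the missing fifth
  class, which completes a sixth factor.\<close>

lemma prod_qpoch_twists:
  fixes \<omega> t :: complex
  assumes "\<omega> ^ 5 = 1" "\<omega> \<noteq> 1" "norm t < 1"
  defines "q \<equiv> t ^ 5"
  shows "(\<Prod>k<5. qpoch (\<omega> ^ k * t) (\<omega> ^ k * t)) * qpoch (q ^ 5) (q ^ 5) = qpoch q q ^ 6"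
proof -
  have q: "norm q < 1" unfolding q_def using assms(3) by (simp add: norm_power power_less_one_iff)
  have "norm \<omega> ^ 5 = 1" using assms(1) by (metis norm_one norm_power)
  hence nw: "norm \<omega> = 1"
    by (metis norm_ge_zero power_eq_imp_eq_base power_one zero_le_one zero_less_numeral)
  have *: "qpoch (\<omega> ^ k * t) (\<omega> ^ k * t) = (\<Prod>j<5. qpoch ((\<omega> ^ Suc j) ^ k * t ^ Suc j) q)" for k
  proof -
    have "(\<omega> ^ k * t) ^ 5 = (\<omega> ^ 5) ^ k * t ^ 5"
      by (simp only: power_mult_distrib power_mult[symmetric] mult.commute)
    hence e: "(\<omega> ^ k * t) ^ 5 = q" using assms(1) by (simp add: q_def)
    have e': "(\<omega> ^ k * t) * (\<omega> ^ k * t) ^ j = (\<omega> ^ Suc j) ^ k * t ^ Suc j" for j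
    proof -
      have "(\<omega> ^ k * t) * (\<omega> ^ k * t) ^ j = (\<omega> ^ k) ^ Suc j * t ^ Suc j"
        by (simp add: power_mult_distrib)
      thus ?thesis by (simp only: power_mult[symmetric] mult.commute)
    qed
    have "norm (\<omega> ^ k * t) < 1" using assms(3) nw by (simp add: norm_mult norm_power)
    from qpoch_dissection[OF this, of 5 "\<omega> ^ k * t"] show ?thesis
      unfolding e e' by simp
  qed
  have "(\<Prod>k<5. qpoch (\<omega> ^ k * t) (\<omega> ^ k * t)) = (\<Prod>j<5. \<Prod>k<5. qpoch ((\<omega> ^ Suc j) ^ k * t ^ Suc j) q)"
    unfolding * by (rule prod.swap)
  also have "\<dots> = (\<Prod>j<4. \<Prod>k<5. qpoch ((\<omega> ^ Suc j) ^ k * t ^ Suc j) q) * qpoch q q ^ 5"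
  proof -
    have split: "(\<Prod>j<5. f j) = (\<Prod>j<4. f j) * f 4" for f :: "nat \<Rightarrow> complex"
      by (simp add: eval_nat_numeral)
    have "(\<Prod>k<5. qpoch ((\<omega> ^ Suc 4) ^ k * t ^ Suc 4) q) = qpoch q q ^ 5"
      using assms(1) by (simp add: q_def)
    thus ?thesis by (subst split) (rule arg_cong)
  qed
  also have "(\<Prod>j<4. \<Prod>k<5. qpoch ((\<omega> ^ Suc j) ^ k * t ^ Suc j) q) = (\<Prod>j<4. qpoch (q * q ^ j) (q ^ 5))"
  proof (rule prod.cong[OF refl])
    fix j :: nat assume "j \<in> {..<4}"
    hence j: "j = 0 \<or> j = 1 \<or> j = 2 \<or> j = 3" by auto
    have "\<omega> ^ 2 = 1 \<Longrightarrow> \<omega> = 1" "\<omega> ^ 3 = 1 \<Longrightarrow> \<omega> = 1" "\<omega> ^ 4 = 1 \<Longrightarrow> \<omega> = 1"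
      using assms(1) by algebra+
    hence ne: "\<omega> ^ Suc j \<noteq> 1" using j assms(2) by (elim disjE) (auto simp: eval_nat_numeral)
    have "(\<omega> ^ Suc j) ^ 5 = (\<omega> ^ 5) ^ Suc j" by (simp only: power_mult[symmetric] mult.commute)
    hence w5: "(\<omega> ^ Suc j) ^ 5 = 1" using assms(1) by simp
    have "(t ^ Suc j) ^ 5 = q ^ Suc j" unfolding q_def by (simp only: power_mult[symmetric] mult.commute)
    thus "(\<Prod>k<5. qpoch ((\<omega> ^ Suc j) ^ k * t ^ Suc j) q) = qpoch (q * q ^ j) (q ^ 5)"
      using prod_qpoch_fifth_roots[OF w5 ne q, of "t ^ Suc j"] by simp
  qed
  finally have "(\<Prod>k<5. qpoch (\<omega> ^ k * t) (\<omega> ^ k * t)) * qpoch (q ^ 5) (q ^ 5) =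
     (\<Prod>j<4. qpoch (q * q ^ j) (q ^ 5)) * qpoch (q * q ^ 4) (q ^ 5) * qpoch q q ^ 5"
    by (simp add: eval_nat_numeral)
  also have "(\<Prod>j<4. qpoch (q * q ^ j) (q ^ 5)) * qpoch (q * q ^ 4) (q ^ 5) = (\<Prod>j<5. qpoch (q * q ^ j) (q ^ 5))"
    by (simp add: eval_nat_numeral)
  also have "\<dots> = qpoch q q" by (rule qpoch_dissection[OF q, symmetric]) simp
  finally show ?thesis by (simp add: eval_nat_numeral)
qed

lemma prod_fifth_roots_quadratic:
  fixes \<omega> v :: complex
  assumes "\<omega> ^ 5 = 1" "\<omega> \<noteq> 1" "v \<noteq> 0"
  shows "(\<Prod>k<5. \<omega> ^ k * v - 1 - 1 / (\<omega> ^ k * v)) = v ^ 5 - 11 - 1 / v ^ 5"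
proof -
  \<comment> \<open>\<open>X - 1 - 1/X = (X - \<alpha>) (X - (1 - \<alpha>)) / X\<close> for the golden ratio \<open>\<alpha>\<close>\<close>
  define \<alpha> :: complex where "\<alpha> = (1 + of_real (sqrt 5)) / 2"
  have "(complex_of_real (sqrt 5)) ^ 2 = 5" by (simp flip: of_real_power)
  hence \<alpha>: "\<alpha> ^ 2 = \<alpha> + 1" by (simp add: \<alpha>_def power2_eq_square field_simps)
  have w0: "\<omega> \<noteq> 0" using assms(1) by auto
  \<comment> \<open>The denominator is written with \<open>- 0\<close> to fit
    \<open>prod_fifth_roots\<close> at \<open>c = 0\<close>.\<close>
  have "(\<Prod>k<5. \<omega> ^ k * v - 1 - 1 / (\<omega> ^ k * v)) = (\<Prod>k<5. (\<omega> ^ k * v - \<alpha>) * (\<omega> ^ k * v - (1 - \<alpha>)) / (\<omega> ^ k * v - 0))"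
  proof (rule prod.cong[OF refl])
    fix k
    have nz: "\<omega> ^ k * v \<noteq> 0" using w0 assms(3) by simp
    have "(X - \<alpha>) * (X - (1 - \<alpha>)) = X * X - X - 1" for X using \<alpha> by algebra
    thus "\<omega> ^ k * v - 1 - 1 / (\<omega> ^ k * v) = (\<omega> ^ k * v - \<alpha>) * (\<omega> ^ k * v - (1 - \<alpha>)) / (\<omega> ^ k * v - 0)"
      using nz by (simp add: diff_divide_distrib)
  qed
  also have "\<dots> = (v ^ 5 - \<alpha> ^ 5) * (v ^ 5 - (1 - \<alpha>) ^ 5) / (v ^ 5 - 0 ^ 5)"
    by (simp only: prod_dividef prod.distrib prod_fifth_roots[OF assms(1,2)])
  \<comment> \<open>Here 11 is the Lucas number \<open>\<alpha> ^ 5 + (1 - \<alpha>) ^ 5\<close>,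
    and the constant term is -1 because \<open>\<alpha> * (1 - \<alpha>) = -1\<close>.\<close>
  also have "(v ^ 5 - \<alpha> ^ 5) * (v ^ 5 - (1 - \<alpha>) ^ 5) = v ^ 5 * v ^ 5 - 11 * v ^ 5 - 1"
    using \<alpha> by algebra
  also have "(v ^ 5 * v ^ 5 - 11 * v ^ 5 - 1) / (v ^ 5 - 0 ^ 5) = v ^ 5 - 11 - 1 / v ^ 5"
  proof -
    have "(X * X - 11 * X - 1) / (X - 0 ^ 5) = X - 11 - 1 / X" if "X \<noteq> 0" for X :: complex
      using that by (simp add: field_simps)
    from this[of "v ^ 5"] show ?thesis using assms(3) by simp
  qed
  finally show ?thesis .
qed

section \<open>The fifth power of the Rogers-Ramanujan continued fraction\<close>

lemma inverse_rogers_ramanujan_nonzero: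
  assumes "Im \<tau> > 0"
  shows "inverse_rogers_ramanujan \<tau> \<noteq> 0"
  using theta1_pi_tau_nonzero[OF assms] by (simp add: inverse_rogers_ramanujan_def)

lemma dedekind_eta_add_24_nat: "dedekind_eta (\<tau> + 24 * of_nat k) = dedekind_eta \<tau>"
proof -
  have "exp (of_real pi * \<i> * (\<tau> + 24 * of_nat k) / 12) = exp (of_real pi * \<i> * \<tau> / 12) * exp (of_int (2 * int k) * (of_real pi * \<i>))"
    unfolding exp_add[symmetric] by (intro arg_cong[where f = exp]) (simp add: field_simps)
  moreover have "exp (2 * of_real pi * \<i> * (\<tau> + 24 * of_nat k)) = exp (2 * of_real pi * \<i> * \<tau>) * exp (of_int (2 * (24 * int k)) * (of_real pi * \<i>))"
    unfolding exp_add[symmetric] by (intro arg_cong[where f = exp]) (simp add: field_simps)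
  ultimately show ?thesis unfolding dedekind_eta_qpoch exp_int_pi_i by simp
qed

text \<open>The modulus \<open>5 * \<tau>\<close> moves by \<open>120 * k\<close>, a multiple of 8,
  and the arguments move by multiples of \<open>2 * pi\<close>, so both theta values stay fixed.
  Only the exponential prefactor changes, and \<open>3 * 24 / 5 = 14 + 2 / 5\<close> leaves a
  primitive fifth root of unity.\<close>

lemma inverse_rogers_ramanujan_add_24_nat:
  assumes "Im \<tau> > 0"
  shows "inverse_rogers_ramanujan (\<tau> + 24 * of_nat k) = exp (2 * of_real pi * \<i> / 5) ^ k * inverse_rogers_ramanujan \<tau>"
proof -
  have im: "Im (5 * \<tau>) > 0" using assms by simp
  have T: "5 * (\<tau> + 24 * of_nat k) = 5 * \<tau> + 8 * of_int (15 * int k)" by simp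
  have "of_real pi * (\<tau> + 24 * of_nat k) = of_real pi * \<tau> + 2 * of_real pi * of_nat (12 * k)"
    by (simp add: algebra_simps)
  hence a: "theta1 (of_real pi * (\<tau> + 24 * of_nat k)) (5 * (\<tau> + 24 * of_nat k)) = theta1 (of_real pi * \<tau>) (5 * \<tau>)"
    by (simp only: T theta1_add_8_int theta1_add_2_pi_nat[OF im])
  have "2 * of_real pi * (\<tau> + 24 * of_nat k) = 2 * of_real pi * \<tau> + 2 * of_real pi * of_nat (24 * k)"
    by (simp add: algebra_simps)
  hence b: "theta1 (2 * of_real pi * (\<tau> + 24 * of_nat k)) (5 * (\<tau> + 24 * of_nat k)) = theta1 (2 * of_real pi * \<tau>) (5 * \<tau>)"
    by (simp only: T theta1_add_8_int theta1_add_2_pi_nat[OF im])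
  have "exp (3 * of_real pi * \<i> * (\<tau> + 24 * of_nat k) / 5) =
      exp (of_nat k * (2 * of_real pi * \<i> / 5)) * exp (of_int (2 * (7 * int k)) * (of_real pi * \<i>)) * exp (3 * of_real pi * \<i> * \<tau> / 5)"
    unfolding exp_add[symmetric] by (intro arg_cong[where f = exp]) (simp add: field_simps)
  hence "exp (3 * of_real pi * \<i> * (\<tau> + 24 * of_nat k) / 5) =
      exp (2 * of_real pi * \<i> / 5) ^ k * exp (3 * of_real pi * \<i> * \<tau> / 5)"
    unfolding exp_int_pi_i exp_of_nat_mult by simp
  thus ?thesis unfolding inverse_rogers_ramanujan_def a b by simp
qed

lemma root_of_unity_5:
  assumes "0 < m" "m < 5"
  shows "exp (2 * of_real pi * \<i> * of_nat m / 5) ^ 5 = (1 :: complex)" "exp (2 * of_real pi * \<i> * of_nat m / 5) \<noteq> (1 :: complex)"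
proof -
  have "exp (2 * of_real pi * \<i> * of_nat m / 5) ^ 5 = exp (of_int (2 * int m) * (of_real pi * \<i>))"
    unfolding exp_of_nat_mult[symmetric] by (intro arg_cong[where f = exp]) simp
  thus "exp (2 * of_real pi * \<i> * of_nat m / 5) ^ 5 = (1 :: complex)" unfolding exp_int_pi_i by simp
  show "exp (2 * of_real pi * \<i> * of_nat m / 5) \<noteq> (1 :: complex)"
  proof
    assume "exp (2 * of_real pi * \<i> * of_nat m / 5) = (1 :: complex)"
    then obtain n :: int where "2 * pi * real m / 5 = of_int (2 * n) * pi"
      by (auto simp: exp_eq_1)
    hence "real m = of_int (5 * n)" by (simp add: field_simps)
    hence "int m = 5 * n" by linarith
    thus False using assms by presburger
  qed
qed

lemma prod_dedekind_eta_fifths: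
  assumes "Im \<tau> > 0"
  shows "(\<Prod>k<5. dedekind_eta ((\<tau> + 24 * of_nat k) / 5)) * dedekind_eta (5 * \<tau>) = dedekind_eta \<tau> ^ 6"
proof -
  \<comment> \<open>The exponent 4 comes from \<open>24 / 5 = 4 + 4 / 5\<close>.\<close>
  define \<omega> :: complex where "\<omega> = exp (2 * of_real pi * \<i> * of_nat 4 / 5)"
  have \<omega>: "\<omega> ^ 5 = 1" "\<omega> \<noteq> 1" unfolding \<omega>_def by (rule root_of_unity_5; simp)+
  define t where "t = exp (2 * of_real pi * \<i> * (\<tau> / 5))"
  have t: "norm t < 1" using assms by (simp add: t_def)
  have t5: "t ^ 5 = exp (2 * of_real pi * \<i> * \<tau>)"
    unfolding t_def exp_of_nat_mult[symmetric] by (simp add: mult_ac)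
  have t25: "(t ^ 5) ^ 5 = exp (2 * of_real pi * \<i> * (5 * \<tau>))"
    unfolding t5 exp_of_nat_mult[symmetric] by (simp add: mult_ac)
  have tk: "exp (2 * of_real pi * \<i> * ((\<tau> + 24 * of_nat k) / 5)) = \<omega> ^ k * t" for k
  proof -
    have "exp (2 * of_real pi * \<i> * ((\<tau> + 24 * of_nat k) / 5)) =
       exp (of_nat k * (2 * of_real pi * \<i> * of_nat 4 / 5)) * exp (of_int (2 * (4 * int k)) * (of_real pi * \<i>)) * t"
      unfolding exp_add[symmetric] t_def by (intro arg_cong[where f = exp]) (simp add: field_simps)
    thus ?thesis unfolding exp_int_pi_i exp_of_nat_mult \<omega>_def by simp
  qed
  have "(\<Prod>k<5. exp (of_real pi * \<i> * ((\<tau> + 24 * of_nat k) / 5) / 12)) = exp (\<Sum>k<5. of_real pi * \<i> * ((\<tau> + 24 * of_nat k) / 5) / 12)"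
    by (simp add: exp_sum)
  \<comment> \<open>The translations contribute \<open>24 * (0 + 1 + 2 + 3 + 4) / 60 = 4\<close>, an
    even multiple of \<open>pi * \<i>\<close>, which the exponential does not see.\<close>
  also have "(\<Sum>k<5. of_real pi * \<i> * ((\<tau> + 24 * of_nat k) / 5) / 12) = of_real pi * \<i> * \<tau> / 12 + of_int 4 * (of_real pi * \<i>)"
    by (simp add: eval_nat_numeral field_simps)
  also have "exp \<dots> = exp (of_real pi * \<i> * \<tau> / 12)"
    unfolding exp_add exp_int_pi_i by simp
  finally have pre: "(\<Prod>k<5. exp (of_real pi * \<i> * ((\<tau> + 24 * of_nat k) / 5) / 12)) = exp (of_real pi * \<i> * \<tau> / 12)" .
  have "exp (of_real pi * \<i> * \<tau> / 12) * exp (of_real pi * \<i> * (5 * \<tau>) / 12) = exp (of_nat 6 * (of_real pi * \<i> * \<tau> / 12))"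
    unfolding exp_add[symmetric] by (intro arg_cong[where f = exp]) (simp add: field_simps)
  hence pre': "exp (of_real pi * \<i> * \<tau> / 12) * exp (of_real pi * \<i> * (5 * \<tau>) / 12) = exp (of_real pi * \<i> * \<tau> / 12) ^ 6"
    unfolding exp_of_nat_mult .
  have "(\<Prod>k<5. dedekind_eta ((\<tau> + 24 * of_nat k) / 5)) * dedekind_eta (5 * \<tau>) =
      (exp (of_real pi * \<i> * \<tau> / 12) * exp (of_real pi * \<i> * (5 * \<tau>) / 12)) *
      ((\<Prod>k<5. qpoch (\<omega> ^ k * t) (\<omega> ^ k * t)) * qpoch ((t ^ 5) ^ 5) ((t ^ 5) ^ 5))"
    unfolding dedekind_eta_qpoch tk prod.distrib pre t25 by (simp only: mult_ac)
  also have "\<dots> = exp (of_real pi * \<i> * \<tau> / 12) ^ 6 * qpoch (t ^ 5) (t ^ 5) ^ 6"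
    unfolding pre' prod_qpoch_twists[OF \<omega> t] ..
  also have "\<dots> = dedekind_eta \<tau> ^ 6"
    unfolding dedekind_eta_qpoch t5 by (rule power_mult_distrib[symmetric])
  finally show ?thesis .
qed

theorem rogers_ramanujan_fifth_power:
  assumes "Im \<tau> > 0"
  defines "v \<equiv> inverse_rogers_ramanujan \<tau>"
  shows "dedekind_eta \<tau> ^ 6 = dedekind_eta (5 * \<tau>) ^ 6 * (v ^ 5 - 11 - 1 / v ^ 5)"
proof -
  define \<zeta> :: complex where "\<zeta> = exp (2 * of_real pi * \<i> / 5)"
  have \<zeta>: "\<zeta> ^ 5 = 1" "\<zeta> \<noteq> 1" using root_of_unity_5[of 1] by (simp_all add: \<zeta>_def)
  have "dedekind_eta ((\<tau> + 24 * of_nat k) / 5) = dedekind_eta (5 * \<tau>) * (\<zeta> ^ k * v - 1 - 1 / (\<zeta> ^ k * v))" for k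
  proof -
    have im: "Im (\<tau> + 24 * of_nat k) > 0" using assms by simp
    have "5 * (\<tau> + 24 * of_nat k) = 5 * \<tau> + 24 * of_nat (5 * k)" by simp
    hence "dedekind_eta (5 * (\<tau> + 24 * of_nat k)) = dedekind_eta (5 * \<tau>)"
      by (simp only: dedekind_eta_add_24_nat)
    thus ?thesis
      unfolding dedekind_eta_fifth[OF im] inverse_rogers_ramanujan_add_24_nat[OF assms(1)] \<zeta>_def v_def by simp
  qed
  hence "dedekind_eta \<tau> ^ 6 = (\<Prod>k<5. dedekind_eta (5 * \<tau>) * (\<zeta> ^ k * v - 1 - 1 / (\<zeta> ^ k * v))) * dedekind_eta (5 * \<tau>)"
    using prod_dedekind_eta_fifths[OF assms(1)] by simp
  also have "\<dots> = dedekind_eta (5 * \<tau>) ^ 5 * (v ^ 5 - 11 - 1 / v ^ 5) * dedekind_eta (5 * \<tau>)"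
    unfolding prod.distrib v_def
      prod_fifth_roots_quadratic[OF \<zeta> inverse_rogers_ramanujan_nonzero[OF assms(1)]] by simp
  also have "\<dots> = dedekind_eta (5 * \<tau>) ^ 6 * (v ^ 5 - 11 - 1 / v ^ 5)"
    by (simp add: eval_nat_numeral)
  finally show ?thesis .
qed

text \<open>In the product formula the first theta value collects the residue classes 1, 4 and 0
  modulo 5 of \<open>qpoch q q\<close>, the second the classes 2, 3 and 0. Together they make up
  \<open>qpoch q q\<close> and one more \<open>qpoch (q ^ 5) (q ^ 5)\<close>.\<close>

lemma theta1_pi_tau_mult:
  assumes "Im \<tau> > 0"
  shows "theta1 (of_real pi * \<tau>) (5 * \<tau>) * theta1 (2 * of_real pi * \<tau>) (5 * \<tau>) =
     - exp (- of_real pi * \<i> * \<tau>) * dedekind_eta \<tau> * dedekind_eta (5 * \<tau>)"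
proof -
  have im: "Im (5 * \<tau>) > 0" using assms by simp
  define q where "q = exp (2 * of_real pi * \<i> * \<tau>)"
  have q: "norm q < 1" "q \<noteq> 0" using assms by (simp_all add: q_def)
  have q5: "exp (2 * of_real pi * \<i> * (5 * \<tau>)) = q ^ 5"
    unfolding q_def exp_of_nat_mult[symmetric] by (simp add: mult_ac)
  \<comment> \<open>The product formula is applied at the negated arguments, where
    \<open>1 / w\<close> is \<open>q\<close> or \<open>q ^ 2\<close> and all exponents are
    positive.\<close>
  have 1: "exp (2 * \<i> * - (of_real pi * \<tau>)) = 1 / q"
    unfolding q_def inverse_eq_divide[symmetric] exp_minus[symmetric] by (simp add: mult_ac)
  have 2: "exp (2 * \<i> * - (2 * of_real pi * \<tau>)) = 1 / q ^ 2"
    unfolding q_def exp_of_nat_mult[symmetric] inverse_eq_divide[symmetric] exp_minus[symmetric] by (simp add: mult_ac)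
  have e: "1 / q * q ^ 5 = q ^ 4" "1 / (1 / q) = q" "1 / q ^ 2 * q ^ 5 = q ^ 3" "1 / (1 / q ^ 2) = q ^ 2"
    using q(2) by (simp_all add: field_simps eval_nat_numeral)
  have a: "theta1 (of_real pi * \<tau>) (5 * \<tau>) =
      \<i> * exp (of_real pi * \<i> * (5 * \<tau>) / 4 + \<i> * - (of_real pi * \<tau>)) * (qpoch (q ^ 5) (q ^ 5) * qpoch (q ^ 4) (q ^ 5) * qpoch q (q ^ 5))"
    using theta1_product[OF im, of "- (of_real pi * \<tau>)"] unfolding theta1_minus[OF im] q5 1 e by simp
  have b: "theta1 (2 * of_real pi * \<tau>) (5 * \<tau>) =
      \<i> * exp (of_real pi * \<i> * (5 * \<tau>) / 4 + \<i> * - (2 * of_real pi * \<tau>)) * (qpoch (q ^ 5) (q ^ 5) * qpoch (q ^ 3) (q ^ 5) * qpoch (q ^ 2) (q ^ 5))"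
    using theta1_product[OF im, of "- (2 * of_real pi * \<tau>)"] unfolding theta1_minus[OF im] q5 2 e by simp
  have "qpoch q q = (\<Prod>j<5. qpoch (q * q ^ j) (q ^ 5))" by (rule qpoch_dissection[OF q(1)]) simp
  also have "\<dots> = qpoch q (q ^ 5) * qpoch (q ^ 2) (q ^ 5) * qpoch (q ^ 3) (q ^ 5) * qpoch (q ^ 4) (q ^ 5) * qpoch (q ^ 5) (q ^ 5)"
    by (simp add: eval_nat_numeral)
  finally have qq: "qpoch q q = \<dots>" .
  have ex: "exp (of_real pi * \<i> * (5 * \<tau>) / 4 + \<i> * - (of_real pi * \<tau>)) * exp (of_real pi * \<i> * (5 * \<tau>) / 4 + \<i> * - (2 * of_real pi * \<tau>)) =
      exp (- of_real pi * \<i> * \<tau>) * exp (of_real pi * \<i> * \<tau> / 12) * exp (of_real pi * \<i> * (5 * \<tau>) / 12)"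
    unfolding exp_add[symmetric] by (intro arg_cong[where f = exp]) (simp add: field_simps)
  have "theta1 (of_real pi * \<tau>) (5 * \<tau>) * theta1 (2 * of_real pi * \<tau>) (5 * \<tau>) =
     (\<i> * \<i>) * (exp (of_real pi * \<i> * (5 * \<tau>) / 4 + \<i> * - (of_real pi * \<tau>)) * exp (of_real pi * \<i> * (5 * \<tau>) / 4 + \<i> * - (2 * of_real pi * \<tau>))) *
     (qpoch q q * qpoch (q ^ 5) (q ^ 5))"
    unfolding a b qq by (simp only: mult_ac)
  also have "\<dots> = - exp (- of_real pi * \<i> * \<tau>) * dedekind_eta \<tau> * dedekind_eta (5 * \<tau>)"
    unfolding ex dedekind_eta_qpoch q5 q_def[symmetric] by (simp add: mult_ac)
  finally show ?thesis .
qed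

section \<open>The theta function identity\<close>

lemma theta_space_power_5:
  assumes "theta_space T d s r f" "d > 0"
  shows "theta_space T (5 * d) (s ^ 5) (5 * r) (\<lambda>x. f x ^ 5)"
proof -
  have "theta_space T (d + (d + (d + (d + d)))) (s * (s * (s * (s * s)))) (r + (r + (r + (r + r))))
      (\<lambda>x. f x * (f x * (f x * (f x * f x))))"
    by (intro theta_space_mult assms) (use assms(2) in auto)
  thus ?thesis by (simp add: eval_nat_numeral)
qed

definition theta1_twist :: "complex \<Rightarrow> nat \<Rightarrow> complex \<Rightarrow> complex" where
  "theta1_twist \<tau> j x = exp (2 * of_nat j * \<i> * x) * theta1 (x + of_nat j * of_real pi * \<tau>) (5 * \<tau>) ^ 5
     - exp (- 2 * of_nat j * \<i> * x) * theta1 (x - of_nat j * of_real pi * \<tau>) (5 * \<tau>) ^ 5"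

lemma theta1_twist_uminus:
  assumes "Im \<tau> > 0"
  shows "theta1_twist \<tau> j (- x) = theta1_twist \<tau> j x"
proof -
  have im: "Im (5 * \<tau>) > 0" using assms by simp
  have "- x + of_nat j * of_real pi * \<tau> = - (x - of_nat j * of_real pi * \<tau>)"
    "- x - of_nat j * of_real pi * \<tau> = - (x + of_nat j * of_real pi * \<tau>)" by simp_all
  hence "theta1 (- x + of_nat j * of_real pi * \<tau>) (5 * \<tau>) = - theta1 (x - of_nat j * of_real pi * \<tau>) (5 * \<tau>)"
    "theta1 (- x - of_nat j * of_real pi * \<tau>) (5 * \<tau>) = - theta1 (x + of_nat j * of_real pi * \<tau>) (5 * \<tau>)"
    by (simp_all only: theta1_minus[OF im])
  thus ?thesis by (simp add: theta1_twist_def)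
qed

text \<open>The fifth power of \<open>theta1\<close> is odd, so the difference is really
  \<open>g x + g (- x)\<close> for its first term \<open>g\<close>. The frequency shift
  \<open>2 * j\<close> is even and preserves the parity of the frequencies.\<close>

lemma theta_space_theta1_twist:
  assumes "Im \<tau> > 0"
  shows "theta_space (5 * \<tau>) 5 (-1) 1 (theta1_twist \<tau> j)"
proof -
  have im: "Im (5 * \<tau>) > 0" using assms by simp
  define g where "g = (\<lambda>x. exp (2 * of_nat j * \<i> * x) * theta1 (x + of_nat j * of_real pi * \<tau>) (5 * \<tau>) ^ 5)"
  have "theta_space (5 * \<tau>) (5 * 1) ((-1) ^ 5) (5 * 1) (\<lambda>x. theta1 x (5 * \<tau>) ^ 5)"
    by (intro theta_space_power_5 theta_space_theta1 im) auto
  hence "theta_space (5 * \<tau>) 5 (-1) 5 (\<lambda>x. theta1 x (5 * \<tau>) ^ 5)" by simp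
  from theta_space_quasi_shift[OF this, of "2 * int j"]
  have "theta_space (5 * \<tau>) 5 (-1) (5 + 2 * int j) g"
    by (simp add: g_def mult_ac)
  hence g: "theta_space (5 * \<tau>) 5 (-1) 1 g" by (rule theta_space_parity) simp
  have g': "theta_space (5 * \<tau>) 5 (-1) 1 (\<lambda>x. g (- x))"
    using theta_space_uminus_arg[OF g] by simp
  have "g x + g (- x) = theta1_twist \<tau> j x" for x
  proof -
    have "- x + of_nat j * of_real pi * \<tau> = - (x - of_nat j * of_real pi * \<tau>)" by simp
    hence "theta1 (- x + of_nat j * of_real pi * \<tau>) (5 * \<tau>) = - theta1 (x - of_nat j * of_real pi * \<tau>) (5 * \<tau>)"
      by (simp only: theta1_minus[OF im])
    thus ?thesis by (simp add: theta1_twist_def g_def)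
  qed
  thus ?thesis using theta_space_add[OF g g'] by simp
qed

text \<open>The shifts by \<open>y\<close> and \<open>- y\<close> change the multiplier by
  reciprocal factors, which cancel in the product; the degrees add up to
  \<open>1 + 1 + 3 = 5\<close>.\<close>

lemma theta_space_theta1_theta1_quint:
  assumes "Im T > 0"
  shows "theta_space T 5 (-1) 1 (\<lambda>x. theta1 (x + y) T * theta1 (x - y) T * quint T x)"
proof -
  have "theta_space T 1 (-1 * exp (2 * \<i> * of_nat 1 * y)) 1 (\<lambda>x. theta1 (x + y) T)"
       "theta_space T 1 (-1 * exp (2 * \<i> * of_nat 1 * - y)) 1 (\<lambda>x. theta1 (x + - y) T)"
    by (intro theta_space_shift theta_space_theta1 assms)+
  hence "theta_space T (1 + 1 + 3) ((-1 * exp (2 * \<i> * of_nat 1 * y)) * (-1 * exp (2 * \<i> * of_nat 1 * - y)) * (-1)) (1 + 1 + 1)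
     (\<lambda>x. theta1 (x + y) T * theta1 (x + - y) T * quint T x)"
    by (intro theta_space_mult theta_space_quint assms) auto
  also have "(-1 * exp (2 * \<i> * of_nat 1 * y)) * (-1 * exp (2 * \<i> * of_nat 1 * - y)) * (-1) = -1"
    by (simp add: exp_add[symmetric])
  finally have "theta_space T 5 (-1) 3 (\<lambda>x. theta1 (x + y) T * theta1 (x - y) T * quint T x)" by simp
  thus ?thesis by (rule theta_space_parity) simp
qed

lemma even_theta_space_5_alternating:
  assumes "Im T > 0"
    and "\<And>y. theta_space T 5 (-1) 1 (\<lambda>x. R x y)" "\<And>x y. R (- x) y = R x y" "\<And>x y. R x y = - R y x"
  obtains K where "\<And>x y. R x y = K * (theta_basis T 1 x * theta_basis T 3 y - theta_basis T 1 y * theta_basis T 3 x)"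
proof (rule alternating_on_plane[of R "theta_basis T 1" "theta_basis T 3"])
  show "\<exists>\<alpha> \<beta>. \<forall>x. R x y = \<alpha> * theta_basis T 1 x + \<beta> * theta_basis T 3 x" for y
    by (rule even_theta_space_5[OF assms(1) assms(2)[of y]]) (use assms(3) in blast)+
  show "R x y = - R y x" for x y by (rule assms(4))
qed (rule that)

theorem theorem4p6:
  fixes \<tau> x y :: complex
  assumes "Im \<tau> > 0"
    and "theta1 x (5 * \<tau>) * theta1 y (5 * \<tau>) \<noteq> 0"
  shows "qpow \<tau> (5 / 2)
        * (exp (2 * \<i> * x) * theta1 (x + of_real pi * \<tau>) (5 * \<tau>) ^ 5
           - exp (- 2 * \<i> * x) * theta1 (x - of_real pi * \<tau>) (5 * \<tau>) ^ 5)
        * (exp (4 * \<i> * y) * theta1 (y + 2 * of_real pi * \<tau>) (5 * \<tau>) ^ 5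
           - exp (- 4 * \<i> * y) * theta1 (y - 2 * of_real pi * \<tau>) (5 * \<tau>) ^ 5)
      - qpow \<tau> (5 / 2)
        * (exp (2 * \<i> * y) * theta1 (y + of_real pi * \<tau>) (5 * \<tau>) ^ 5
           - exp (- 2 * \<i> * y) * theta1 (y - of_real pi * \<tau>) (5 * \<tau>) ^ 5)
        * (exp (4 * \<i> * x) * theta1 (x + 2 * of_real pi * \<tau>) (5 * \<tau>) ^ 5
           - exp (- 4 * \<i> * x) * theta1 (x - 2 * of_real pi * \<tau>) (5 * \<tau>) ^ 5)
    = (10 * dedekind_eta \<tau> ^ 4 * dedekind_eta (5 * \<tau>) ^ 4
         + dedekind_eta \<tau> ^ 10 / dedekind_eta (5 * \<tau>) ^ 2)
      * ((theta1 (x + y) (5 * \<tau>) * theta1 (x - y) (5 * \<tau>)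
            * theta1 (2 * x) (5 * \<tau>) * theta1 (2 * y) (5 * \<tau>))
         / (theta1 x (5 * \<tau>) * theta1 y (5 * \<tau>)))"
proof -
  have im: "Im (5 * \<tau>) > 0" using assms(1) by simp
  define th where "th = (\<lambda>x. theta1 x (5 * \<tau>))"
  define D where "D = (\<lambda>x y. theta1_twist \<tau> 1 x * theta1_twist \<tau> 2 y - theta1_twist \<tau> 1 y * theta1_twist \<tau> 2 x)"
  \<comment> \<open>By the quintuple product identity this is
    \<open>dedekind_eta (5 * \<tau>) ^ 2\<close> times the theta quotient of the theorem, but
    meaningful for all \<open>x\<close> and \<open>y\<close>, as the argument with function spaces
    requires.\<close>
  define R where "R = (\<lambda>x y. th (x + y) * th (x - y) * quint (5 * \<tau>) x * quint (5 * \<tau>) y)"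
  define C where "C = 10 * dedekind_eta \<tau> ^ 4 * dedekind_eta (5 * \<tau>) ^ 4 + dedekind_eta \<tau> ^ 10 / dedekind_eta (5 * \<tau>) ^ 2"
  define \<eta> where "\<eta> = dedekind_eta (5 * \<tau>)"
  define \<eta>1 where "\<eta>1 = dedekind_eta \<tau>"
  have \<eta>: "\<eta> \<noteq> 0" unfolding \<eta>_def by (rule dedekind_eta_nonzero[OF im])
  have odd: "th (- z) = - th z" for z unfolding th_def by (rule theta1_minus[OF im])
  obtain K1 where K1: "\<And>x y. D x y = K1 * (theta_basis (5 * \<tau>) 1 x * theta_basis (5 * \<tau>) 3 y - theta_basis (5 * \<tau>) 1 y * theta_basis (5 * \<tau>) 3 x)"
  proof (rule even_theta_space_5_alternating[OF im, of D])
    show "theta_space (5 * \<tau>) 5 (-1) 1 (\<lambda>x. D x y)" for y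
    proof -
      have "theta_space (5 * \<tau>) 5 (-1) 1 (\<lambda>x. theta1_twist \<tau> 2 y * theta1_twist \<tau> 1 x + (- theta1_twist \<tau> 1 y) * theta1_twist \<tau> 2 x)"
        by (intro theta_space_add theta_space_cmult theta_space_theta1_twist assms)
      thus ?thesis by (simp add: D_def mult.commute)
    qed
    show "D (- x) y = D x y" for x y by (simp add: D_def theta1_twist_uminus[OF assms(1)])
  qed (auto simp: D_def)
  obtain K2 where K2: "\<And>x y. R x y = K2 * (theta_basis (5 * \<tau>) 1 x * theta_basis (5 * \<tau>) 3 y - theta_basis (5 * \<tau>) 1 y * theta_basis (5 * \<tau>) 3 x)"
  proof (rule even_theta_space_5_alternating[OF im, of R])
    show "theta_space (5 * \<tau>) 5 (-1) 1 (\<lambda>x. R x y)" for y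
    proof -
      have "theta_space (5 * \<tau>) 5 (-1) 1 (\<lambda>x. quint (5 * \<tau>) y * (th (x + y) * th (x - y) * quint (5 * \<tau>) x))"
        unfolding th_def by (intro theta_space_cmult theta_space_theta1_theta1_quint im)
      thus ?thesis by (simp add: R_def mult_ac)
    qed
    show "R (- x) y = R x y" for x y
    proof -
      have "- x + y = - (x - y)" "- x - y = - (x + y)" by simp_all
      thus ?thesis unfolding R_def by (simp only: odd quint_uminus[OF im]) simp
    qed
    show "R x y = - R y x" for x y
      using odd[of "x - y"] by (simp add: R_def add.commute)
  qed auto
  \<comment> \<open>At \<open>x = u\<close>, \<open>y = 2 * u\<close> the arguments are multiples of
    \<open>u\<close> between \<open>- u\<close> and \<open>4 * u\<close>; the quasi-period
    \<open>5 * u\<close> brings \<open>3 * u\<close> and \<open>4 * u\<close> back to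
    \<open>2 * u\<close> and \<open>u\<close>.\<close>
  define u where "u = of_real pi * \<tau>"
  define a where "a = th u"
  define b where "b = th (2 * u)"
  define e where "e = exp (of_real pi * \<i> * \<tau>)"
  have enz: "e \<noteq> 0" by (simp add: e_def)
  have u2: "2 * of_real pi * \<tau> = 2 * u" "3 * of_real pi * \<tau> = 3 * u" "4 * of_real pi * \<tau> = 4 * u"
    by (simp_all add: u_def)
  have nz: "a \<noteq> 0" "b \<noteq> 0"
    using theta1_pi_tau_nonzero[OF assms(1)] unfolding u2 u_def[symmetric] by (simp_all add: a_def b_def th_def)
  have em: "exp (- of_real pi * \<i> * \<tau>) = 1 / e" "exp (- 3 * of_real pi * \<i> * \<tau>) = 1 / e ^ 3"
  proof -
    have "exp (- of_real pi * \<i> * \<tau>) = exp (- (of_real pi * \<i> * \<tau>))" by simp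
    thus "exp (- of_real pi * \<i> * \<tau>) = 1 / e" unfolding exp_minus inverse_eq_divide e_def .
    have "exp (- 3 * of_real pi * \<i> * \<tau>) = exp (- (of_nat 3 * (of_real pi * \<i> * \<tau>)))"
      by (simp add: mult.assoc)
    thus "exp (- 3 * of_real pi * \<i> * \<tau>) = 1 / e ^ 3" unfolding exp_minus inverse_eq_divide e_def exp_of_nat_mult .
  qed
  have th3: "th (3 * u) = b / e"
    using theta1_3_pi_tau[OF assms(1)] unfolding u2 em by (simp add: th_def b_def)
  have th4: "th (4 * u) = a / e ^ 3"
    using theta1_4_pi_tau[OF assms(1)] unfolding u2 em u_def[symmetric] by (simp add: th_def a_def)
  have q1: "quint (5 * \<tau>) u = \<eta> * b / a" and q2: "quint (5 * \<tau>) (2 * u) = \<eta> * a / (b * e ^ 3)"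
    using quint_pi_tau[OF assms(1)] unfolding u2 em u_def[symmetric]
    by (simp_all add: th_def a_def b_def \<eta>_def)
  \<comment> \<open>This value is nonzero, which makes \<open>(u, 2 * u)\<close> a reference pair
    for comparing the two alternating forms.\<close>
  have R0: "R u (2 * u) = - a * b * \<eta> ^ 2 / e ^ 4"
  proof -
    have "u + 2 * u = 3 * u" "u - 2 * u = - u" by simp_all
    hence "R u (2 * u) = th (3 * u) * th (- u) * quint (5 * \<tau>) u * quint (5 * \<tau>) (2 * u)" by (simp only: R_def)
    also have "\<dots> = (b / e) * (- a) * (\<eta> * b / a) * (\<eta> * a / (b * e ^ 3))"
      unfolding th3 odd q1 q2 a_def ..
    also have "\<dots> = - a * b * \<eta> ^ 2 / e ^ 4"
      using nz enz by (simp add: field_simps eval_nat_numeral)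
    finally show ?thesis .
  qed
  have ex: "exp (of_nat k * \<i> * (of_nat m * u)) = e ^ (k * m)" "exp (- of_nat k * \<i> * (of_nat m * u)) = 1 / e ^ (k * m)" for k m
  proof -
    have "exp (of_nat k * \<i> * (of_nat m * u)) = exp (of_nat (k * m) * (of_real pi * \<i> * \<tau>))"
      unfolding u_def by (intro arg_cong[where f = exp]) simp
    thus 1: "exp (of_nat k * \<i> * (of_nat m * u)) = e ^ (k * m)" unfolding exp_of_nat_mult e_def .
    have "exp (- of_nat k * \<i> * (of_nat m * u)) = inverse (exp (of_nat k * \<i> * (of_nat m * u)))"
      unfolding exp_minus[symmetric] by simp
    thus "exp (- of_nat k * \<i> * (of_nat m * u)) = 1 / e ^ (k * m)" unfolding 1 inverse_eq_divide .
  qed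
  have th0: "th 0 = 0" using odd[of 0] by simp
  have f11: "theta1_twist \<tau> 1 u = e ^ 2 * b ^ 5"
  proof -
    have "theta1_twist \<tau> 1 u = exp (of_nat 2 * \<i> * (of_nat 1 * u)) * th (2 * u) ^ 5 - exp (- of_nat 2 * \<i> * (of_nat 1 * u)) * th 0 ^ 5"
      by (simp add: theta1_twist_def th_def u_def[symmetric])
    thus ?thesis unfolding ex th0 by (simp add: b_def)
  qed
  have f12: "theta1_twist \<tau> 1 (2 * u) = b ^ 5 / e - a ^ 5 / e ^ 4"
  proof -
    have "2 * u + u = 3 * u" "2 * u - u = u" by simp_all
    hence "theta1_twist \<tau> 1 (2 * u) = exp (of_nat 2 * \<i> * (of_nat 2 * u)) * th (3 * u) ^ 5 - exp (- of_nat 2 * \<i> * (of_nat 2 * u)) * th u ^ 5"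
      by (simp add: theta1_twist_def th_def u_def[symmetric])
    thus ?thesis unfolding ex th3 a_def[symmetric] using enz by (simp add: field_simps eval_nat_numeral)
  qed
  have f21: "theta1_twist \<tau> 2 u = b ^ 5 / e + a ^ 5 / e ^ 4"
  proof -
    have "u + 2 * u = 3 * u" "u - 2 * u = - u" by simp_all
    hence "theta1_twist \<tau> 2 u = exp (of_nat 4 * \<i> * (of_nat 1 * u)) * th (3 * u) ^ 5 - exp (- of_nat 4 * \<i> * (of_nat 1 * u)) * th (- u) ^ 5"
      by (simp add: theta1_twist_def th_def u2)
    thus ?thesis unfolding ex th3 odd a_def[symmetric] using enz by (simp add: field_simps eval_nat_numeral)
  qed
  have f22: "theta1_twist \<tau> 2 (2 * u) = a ^ 5 / e ^ 7"
  proof -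
    have "2 * u + 2 * u = 4 * u" "2 * u - 2 * u = 0" by simp_all
    hence "theta1_twist \<tau> 2 (2 * u) = exp (of_nat 4 * \<i> * (of_nat 2 * u)) * th (4 * u) ^ 5 - exp (- of_nat 4 * \<i> * (of_nat 2 * u)) * th 0 ^ 5"
      by (simp add: theta1_twist_def th_def u2)
    thus ?thesis unfolding ex th4 th0 using enz by (simp add: field_simps eval_nat_numeral)
  qed
  have q52: "qpow \<tau> (5 / 2) = e ^ 5"
  proof -
    have "qpow \<tau> (5 / 2) = exp (of_nat 5 * (of_real pi * \<i> * \<tau>))"
      unfolding qpow_def by (intro arg_cong[where f = exp]) simp
    thus ?thesis unfolding exp_of_nat_mult e_def .
  qed
  define v where "v = inverse_rogers_ramanujan \<tau>"
  have v5: "v ^ 5 = e ^ 3 * b ^ 5 / a ^ 5"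
  proof -
    have "exp (3 * of_real pi * \<i> * \<tau> / 5) ^ 5 = exp (of_nat 3 * (of_real pi * \<i> * \<tau>))"
      unfolding exp_of_nat_mult[symmetric] by (intro arg_cong[where f = exp]) simp
    hence "exp (3 * of_real pi * \<i> * \<tau> / 5) ^ 5 = e ^ 3" unfolding exp_of_nat_mult e_def .
    thus ?thesis
      unfolding v_def inverse_rogers_ramanujan_def u2 u_def[symmetric]
      by (simp add: a_def b_def th_def power_mult_distrib power_divide)
  qed
  have ab: "a * b = - \<eta>1 * \<eta> / e"
    using theta1_pi_tau_mult[OF assms(1)] unfolding u2 em u_def[symmetric]
    by (simp add: a_def b_def th_def \<eta>_def \<eta>1_def)
  \<comment> \<open>The continued fraction identity turns the second summand of \<open>C\<close>
    into \<open>\<eta>1 ^ 4 * \<eta> ^ 4 * (v ^ 5 - 11 - 1 / v ^ 5)\<close>; the first summand, 10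
    times the same eta product, raises -11 to -1.\<close>
  have C: "C = (a * b) ^ 4 * e ^ 4 * (v ^ 5 - 1 - 1 / v ^ 5)"
  proof -
    have "\<eta>1 ^ 6 = \<eta> ^ 6 * (v ^ 5 - 11 - 1 / v ^ 5)"
      using rogers_ramanujan_fifth_power[OF assms(1)] by (simp add: \<eta>_def \<eta>1_def v_def)
    hence "\<eta>1 ^ 10 / \<eta> ^ 2 = \<eta>1 ^ 4 * (\<eta> ^ 6 * (v ^ 5 - 11 - 1 / v ^ 5)) / \<eta> ^ 2"
      by (simp flip: power_add add: \<open>\<eta>1 ^ 6 = _\<close>[symmetric])
    also have "\<dots> = \<eta>1 ^ 4 * \<eta> ^ 4 * (v ^ 5 - 11 - 1 / v ^ 5)"
      using \<eta> by (simp add: eval_nat_numeral)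
    finally have "C = \<eta>1 ^ 4 * \<eta> ^ 4 * (v ^ 5 - 1 - 1 / v ^ 5)"
      unfolding C_def \<eta>_def[symmetric] \<eta>1_def[symmetric] by (simp add: algebra_simps)
    moreover have "(a * b) ^ 4 * e ^ 4 = \<eta>1 ^ 4 * \<eta> ^ 4"
      unfolding ab using enz by (simp add: power_mult_distrib power_divide)
    ultimately show ?thesis by simp
  qed
  have D0: "e ^ 5 * D u (2 * u) * \<eta> ^ 2 = C * R u (2 * u)"
  proof -
    have "e ^ 5 * D u (2 * u) = (a * b) ^ 5 - e ^ 3 * b ^ 10 + a ^ 10 / e ^ 3"
      unfolding D_def f11 f12 f21 f22 using enz by (simp add: field_simps eval_nat_numeral)
    \<comment> \<open>After division by \<open>- ((a * b) ^ 5)\<close> the outer terms become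
      \<open>e ^ 3 * b ^ 5 / a ^ 5 = v ^ 5\<close> and minus its inverse.\<close>
    also have "\<dots> = - ((a * b) ^ 5) * (v ^ 5 - 1 - 1 / v ^ 5)"
      unfolding v5 using nz enz by (simp add: field_simps eval_nat_numeral)
    finally have D: "e ^ 5 * D u (2 * u) = - ((a * b) ^ 5) * (v ^ 5 - 1 - 1 / v ^ 5)" .
    have "(a * b) ^ 5 = (a * b) ^ 4 * (a * b)" by (simp add: eval_nat_numeral)
    thus ?thesis unfolding D R0 C using enz by simp
  qed
  have R0nz: "R u (2 * u) \<noteq> 0" unfolding R0 using nz enz \<eta> by simp
  \<comment> \<open>\<open>D\<close> and \<open>R\<close> are \<open>K1\<close> and
    \<open>K2\<close> times the same determinant, so the cross products agree; the nonzero
    \<open>R u (2 * u)\<close> is cancelled afterwards.\<close>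
  have "D x y * R u (2 * u) = R x y * D u (2 * u)" unfolding K1 K2 by simp
  hence "e ^ 5 * D x y * \<eta> ^ 2 * R u (2 * u) = R x y * (e ^ 5 * D u (2 * u) * \<eta> ^ 2)" by (simp add: mult_ac)
  hence "e ^ 5 * D x y * \<eta> ^ 2 = C * R x y" unfolding D0 using R0nz by (simp add: mult_ac)
  hence main: "e ^ 5 * D x y = C * (R x y / \<eta> ^ 2)" using \<eta> by (simp add: field_simps)
  have xy: "th x \<noteq> 0" "th y \<noteq> 0" using assms(2) by (auto simp: th_def)
  have q: "quint (5 * \<tau>) x = \<eta> * th (2 * x) / th x" "quint (5 * \<tau>) y = \<eta> * th (2 * y) / th y"
    using quintuple_product_identity[OF im, of x] quintuple_product_identity[OF im, of y] xy
    by (simp_all add: th_def \<eta>_def field_simps)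
  have "R x y / \<eta> ^ 2 = th (x + y) * th (x - y) * th (2 * x) * th (2 * y) / (th x * th y)"
    unfolding R_def q using \<eta> xy by (simp add: power2_eq_square)
  with main have "e ^ 5 * D x y = C * (th (x + y) * th (x - y) * th (2 * x) * th (2 * y) / (th x * th y))" by simp
  moreover have "e ^ 5 * D x y = e ^ 5 * theta1_twist \<tau> 1 x * theta1_twist \<tau> 2 y - e ^ 5 * theta1_twist \<tau> 1 y * theta1_twist \<tau> 2 x"
    by (simp add: D_def algebra_simps)
  ultimately show ?thesis
    unfolding q52 C_def th_def by (simp add: theta1_twist_def)
qed

end
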